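(* Let $\exists\alpha\,A$ be a closed formula. Suppose $\Gamma\vdash t:\exists\alpha\,A$ in $\mathsf{IL}+\mathsf{EM}_1^-$ for a quasi-closed proof term $t$, and $t\mapsto^* t'$ with $t'$ in normal form. Then $\Gamma\vdash t':\exists\alpha\,A$ and $t'$ is a Herbrand normal form $$((\dots((m_0,u_0)\mid(m_1,u_1))\mid\dots)\mid(m_k,u_k)).$$ Moreover, $\Gamma\vdash A[m_0/\alpha]\lor\dots\lor A[m_k/\alpha]$ is derivable in $\mathsf{IL}+\mathsf{EM}_1^-$.
   Context: Fix a first-order language $\mathcal{L}$; formulas are built from atomic formulas and $\bot$ with $\land,\lor,\rightarrow,\forall,\exists$, $\lnot A:=A\rightarrow\bot$. A propositional formula is quantifier-free; it is negative if $\lor$ does not occur in it; a simply universal formula is one of the form $\forall\alpha_1\dots\forall\alpha_k P$ with $P$ negative propositional. Proof terms of $\mathsf{IL}+\mathsf{EM}_1^-$: $t,u,v::= x\mid tu\mid tm\mid\lambda x.u\mid\lambda\alpha.u\mid\langle t,u\rangle\mid\pi_0u\mid\pi_1u\mid\iota_0(u)\mid\iota_1(u)\mid t[x.u,y.v]\mid(m,t)\mid t[(\alpha,x).u]\mid (u\mid v)\mid (u\parallel_a v)\mid \mathsf{H}_a^{\alpha A}\mid \mathsf{W}_a^{\alpha P}\mid \mathsf{H}_0^{P}$, with $m$ first-order terms, $x,y$ proof variables, $a$ hypothesis variables, $\alpha$ first-order variables, $A$ negative propositional or simply universal, $P$ negative propositional. Judgments $\Gamma\vdash t:A$, $\Gamma$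 a list of distinct (proof or hypothesis) variables with formulas, are generated by the usual intuitionistic rules: $\Gamma,x:A\vdash x:A$; $\langle u,t\rangle:A\land B$ from $u:A,t:B$; $\pi_0u:A$, $\pi_1u:B$ from $u:A\land B$; $tu:B$ from $t:A\rightarrow B,u:A$; $\lambda x.u:A\rightarrow B$ from $\Gamma,x:A\vdash u:B$; $\iota_0(u):A\lor B$ from $u:A$, $\iota_1(u):A\lor B$ from $u:B$; $u[x.w_1,y.w_2]:C$ from $u:A\lor B$, $\Gamma,x:A\vdash w_1:C$, $\Gamma,y:B\vdash w_2:C$; $um:A[m/\alpha]$ from $u:\forall\alpha A$; $\lambda\alpha.u:\forall\alpha A$ from $u:A$ ($\alpha$ not free in $\Gamma$); $(m,u):\exists\alpha A$ from $u:A[m/\alpha]$; $u[(\alpha,x).t]:C$ from $u:\exists\alpha A$ and $\Gamma,x:A\vdash t:C$ ($\alpha$ not free in $C,\Gamma$); plus the axioms $\Gamma,a:\forall\alpha A\vdash\mathsf{H}_a^{\alpha A}:\forall\alpha A$; $\Gamma,a:\exists\alpha P\vdash\mathsf{W}_a^{\alpha P}:\exists\alpha P$; $\Gamma,a:P\vdash\mathsf{H}_0^P:P$; $\Gamma\vdash\mathsf{H}_0^{\bot\rightarrow P}:\bot\rightarrow P$; the rule $\mathsf{EM}_0$: from $\Gamma,a:\lnot P\vdash u:C$ and $\Gamma,a:P\vdash v:C$ ($P$ negative propositional) infer $\Gamma\vdash (u\mid v):C$; and the rule $\mathsf{EM}_1^-$: from $\Gamma,a:\forall\alpha P\vdash u:\exists\beta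 Q$ and $\Gamma,a:\exists\alpha\lnot P\vdash v:\exists\beta Q$ ($P,Q$ negative propositional) infer $\Gamma\vdash(u\parallel_a v):\exists\beta Q$; in $u\parallel_a v$ the variable $a$ is bound, its free occurrences in $u$ are all within subterms $\mathsf{H}_a^{\alpha P}$ and in $v$ within subterms $\mathsf{W}_a^{\alpha\lnot P}$. Exception substitution: $v[a:=m]$ replaces each free $\mathsf{W}_a^{\alpha\lnot P}$ in $v$ by $(m,\mathsf{H}_0^{\lnot P[m/\alpha]})$; $u[a:=m]$ replaces each subterm $\mathsf{H}_a^{\alpha P}m$ (free $a$) of $u$ by $\mathsf{H}_0^{P[m/\alpha]}$. A subterm $\mathsf{H}_a^{\alpha P}m$ is active if its only free variable is $a$. Reduction rules (applicable to any subterm): $(\lambda x.u)t\mapsto u[t/x]$; $(\lambda\alpha.u)m\mapsto u[m/\alpha]$; $\pi_i\langle u_0,u_1\rangle\mapsto u_i$; $\iota_i(u)[x_0.t_0,x_1.t_1]\mapsto t_i[u/x_i]$; $(m,u)[(\alpha,x).v]\mapsto v[m/\alpha][u/x]$; permutations $(u\mid v)w\mapsto (uw\mid vw)$ ($w$ a proof term or first-order term), $\pi_i(u\mid v)\mapsto(\pi_iu\mid\pi_iv)$, $(u\mid v)[x.w_1,y.w_2]\mapsto(u[x.w_1,y.w_2]\mid v[x.w_1,y.w_2])$, $(u\mid v)[(\alpha,x).w]\mapsto(u[(\alpha,x).w]\mid v[(\alpha,x).w])$; $u\parallel_a v\mapsto u$ if $a$ is not free in $u$; $u\parallel_a v\mapsto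 (v[a:=m]\mid (u[a:=m]\parallel_a v))$ whenever $u$ has an active subterm $\mathsf{H}_a^{\alpha P}m$. A term is in normal form if it contains no redex; $\mapsto^*$ is the reflexive-transitive closure of $\mapsto$. A proof term is quasi-closed if its only free variables are hypothesis variables $a_1,\dots,a_n$, each occurrence of which is of the form $\mathsf{H}_{a_i}^{\vec\alpha P_i}$ with $\forall\vec\alpha\,P_i$ simply universal. Herbrand normal forms are defined inductively: every normal term $(m,u)$ is one, and if $u,v$ are Herbrand normal forms then so is $(u\mid v)$. *)

theory Defs
  imports Main
begin

text \<open>
  All three kinds of bound variables (first-order variables, proof variables, hypothesis variables)
  are represented by de Bruijn indices, each kind having its own index space, so that
  alpha-equivalent expressions are equal. Substitutions are simultaneous.
\<close>

section \<open>First-order language\<close>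

datatype 'f tm = Var nat | Fn 'f "'f tm list"

datatype ('f, 'p) fm =
    Bot
  | Atom 'p "'f tm list"
  | And "('f, 'p) fm" "('f, 'p) fm"
  | Or "('f, 'p) fm" "('f, 'p) fm"
  | Imp "('f, 'p) fm" "('f, 'p) fm"
  | All "('f, 'p) fm"
  | Ex "('f, 'p) fm"

abbreviation Neg :: "('f, 'p) fm \<Rightarrow> ('f, 'p) fm" where
  "Neg A \<equiv> Imp A Bot"

text \<open>A language is given by its function and predicate symbols, each with its arity; the raw
  syntax above does not enforce arities, the following predicates do.\<close>

record ('f, 'p) lang =
  funs :: "('f \<times> nat) set"
  preds :: "('p \<times> nat) set"

primrec tm_over :: "('f, 'p) lang \<Rightarrow> 'f tm \<Rightarrow> bool" where
  "tm_over L (Var n) = True"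
| "tm_over L (Fn f ts) = ((f, length ts) \<in> funs L \<and> list_all (tm_over L) ts)"

primrec fm_over :: "('f, 'p) lang \<Rightarrow> ('f, 'p) fm \<Rightarrow> bool" where
  "fm_over L Bot = True"
| "fm_over L (Atom p ts) = ((p, length ts) \<in> preds L \<and> list_all (tm_over L) ts)"
| "fm_over L (And A B) = (fm_over L A \<and> fm_over L B)"
| "fm_over L (Or A B) = (fm_over L A \<and> fm_over L B)"
| "fm_over L (Imp A B) = (fm_over L A \<and> fm_over L B)"
| "fm_over L (All A) = fm_over L A"
| "fm_over L (Ex A) = fm_over L A"

text \<open>The set of free variables below a binder, seen from outside the binder.\<close>

definition unbind :: "nat set \<Rightarrow> nat set" where
  "unbind X = {n. Suc n \<in> X}"

primrec tm_fv :: "'f tm \<Rightarrow> nat set" where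
  "tm_fv (Var n) = {n}"
| "tm_fv (Fn f ts) = \<Union>(set (map tm_fv ts))"

primrec fm_fv :: "('f, 'p) fm \<Rightarrow> nat set" where
  "fm_fv Bot = {}"
| "fm_fv (Atom p ts) = \<Union>(set (map tm_fv ts))"
| "fm_fv (And A B) = fm_fv A \<union> fm_fv B"
| "fm_fv (Or A B) = fm_fv A \<union> fm_fv B"
| "fm_fv (Imp A B) = fm_fv A \<union> fm_fv B"
| "fm_fv (All A) = unbind (fm_fv A)"
| "fm_fv (Ex A) = unbind (fm_fv A)"

primrec tm_subst :: "(nat \<Rightarrow> 'f tm) \<Rightarrow> 'f tm \<Rightarrow> 'f tm" where
  "tm_subst \<sigma> (Var n) = \<sigma> n"
| "tm_subst \<sigma> (Fn f ts) = Fn f (map (tm_subst \<sigma>) ts)"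

definition tm_lift :: "'f tm \<Rightarrow> 'f tm" where
  "tm_lift = tm_subst (\<lambda>n. Var (Suc n))"

definition tm_up :: "(nat \<Rightarrow> 'f tm) \<Rightarrow> nat \<Rightarrow> 'f tm" where
  "tm_up \<sigma> = case_nat (Var 0) (\<lambda>n. tm_lift (\<sigma> n))"

primrec fm_subst :: "(nat \<Rightarrow> 'f tm) \<Rightarrow> ('f, 'p) fm \<Rightarrow> ('f, 'p) fm" where
  "fm_subst \<sigma> Bot = Bot"
| "fm_subst \<sigma> (Atom p ts) = Atom p (map (tm_subst \<sigma>) ts)"
| "fm_subst \<sigma> (And A B) = And (fm_subst \<sigma> A) (fm_subst \<sigma> B)"
| "fm_subst \<sigma> (Or A B) = Or (fm_subst \<sigma> A) (fm_subst \<sigma> B)"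
| "fm_subst \<sigma> (Imp A B) = Imp (fm_subst \<sigma> A) (fm_subst \<sigma> B)"
| "fm_subst \<sigma> (All A) = All (fm_subst (tm_up \<sigma>) A)"
| "fm_subst \<sigma> (Ex A) = Ex (fm_subst (tm_up \<sigma>) A)"

definition fm_lift :: "('f, 'p) fm \<Rightarrow> ('f, 'p) fm" where
  "fm_lift = fm_subst (\<lambda>n. Var (Suc n))"

text \<open>\<open>fm_inst m A\<close> is \<open>A[m/\<alpha>]\<close>, where \<open>\<alpha>\<close> is the variable with index 0 in \<open>A\<close>.\<close>

definition fm_inst :: "'f tm \<Rightarrow> ('f, 'p) fm \<Rightarrow> ('f, 'p) fm" where
  "fm_inst m = fm_subst (case_nat m Var)"

primrec neg_prop :: "('f, 'p) fm \<Rightarrow> bool" where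
  "neg_prop Bot = True"
| "neg_prop (Atom p ts) = True"
| "neg_prop (And A B) = (neg_prop A \<and> neg_prop B)"
| "neg_prop (Or A B) = False"
| "neg_prop (Imp A B) = (neg_prop A \<and> neg_prop B)"
| "neg_prop (All A) = False"
| "neg_prop (Ex A) = False"

text \<open>The empty quantifier prefix is allowed.\<close>

definition simply_universal :: "('f, 'p) fm \<Rightarrow> bool" where
  "simply_universal A \<longleftrightarrow> (\<exists>k P. neg_prop P \<and> A = (All ^^ k) P)"


section \<open>Proof terms\<close>

text \<open>
  Binding structure: \<open>Lam\<close> and both branches of \<open>Case\<close> bind a proof variable; \<open>TLam\<close> and the formula
  in \<open>HypA\<close>, \<open>HypW\<close> bind a first-order variable; the second argument of \<open>Unpack\<close> binds a
  first-order variable and a proof variable; both arguments of \<open>EM1\<close> bind a hypothesis variable.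
  \<open>EM0\<close> binds nothing.
  \<open>HypA a A\<close> is \<open>H\<^sub>a\<close> annotated with \<open>\<alpha> A\<close>, \<open>HypW a P\<close> is \<open>W\<^sub>a\<close> annotated with \<open>\<alpha> P\<close>,
  and \<open>HypZ P\<close> is \<open>H\<^sub>0\<close> annotated with \<open>P\<close>. The restrictions on the annotations, and on which kinds of
  hypotheses a bound hypothesis variable may occur in, are imposed by the typing rules.
\<close>

datatype ('f, 'p) pt =
    PVar nat
  | App "('f, 'p) pt" "('f, 'p) pt"
  | TApp "('f, 'p) pt" "'f tm"
  | Lam "('f, 'p) pt"
  | TLam "('f, 'p) pt"
  | Pair "('f, 'p) pt" "('f, 'p) pt"
  | Fst "('f, 'p) pt"
  | Snd "('f, 'p) pt"
  | InL "('f, 'p) pt"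
  | InR "('f, 'p) pt"
  | Case "('f, 'p) pt" "('f, 'p) pt" "('f, 'p) pt"
  | Wit "'f tm" "('f, 'p) pt"
  | Unpack "('f, 'p) pt" "('f, 'p) pt"
  | EM0 "('f, 'p) pt" "('f, 'p) pt"
  | EM1 "('f, 'p) pt" "('f, 'p) pt"
  | HypA nat "('f, 'p) fm"
  | HypW nat "('f, 'p) fm"
  | HypZ "('f, 'p) fm"

text \<open>Free proof variables.\<close>

primrec pt_pv :: "('f, 'p) pt \<Rightarrow> nat set" where
  "pt_pv (PVar n) = {n}"
| "pt_pv (App t u) = pt_pv t \<union> pt_pv u"
| "pt_pv (TApp t m) = pt_pv t"
| "pt_pv (Lam t) = unbind (pt_pv t)"
| "pt_pv (TLam t) = pt_pv t"
| "pt_pv (Pair t u) = pt_pv t \<union> pt_pv u"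
| "pt_pv (Fst t) = pt_pv t"
| "pt_pv (Snd t) = pt_pv t"
| "pt_pv (InL t) = pt_pv t"
| "pt_pv (InR t) = pt_pv t"
| "pt_pv (Case t u v) = pt_pv t \<union> unbind (pt_pv u) \<union> unbind (pt_pv v)"
| "pt_pv (Wit m t) = pt_pv t"
| "pt_pv (Unpack t u) = pt_pv t \<union> unbind (pt_pv u)"
| "pt_pv (EM0 t u) = pt_pv t \<union> pt_pv u"
| "pt_pv (EM1 t u) = pt_pv t \<union> pt_pv u"
| "pt_pv (HypA a A) = {}"
| "pt_pv (HypW a A) = {}"
| "pt_pv (HypZ A) = {}"

text \<open>Free first-order variables, including those of the annotations.\<close>

primrec pt_fv :: "('f, 'p) pt \<Rightarrow> nat set" where
  "pt_fv (PVar n) = {}"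
| "pt_fv (App t u) = pt_fv t \<union> pt_fv u"
| "pt_fv (TApp t m) = pt_fv t \<union> tm_fv m"
| "pt_fv (Lam t) = pt_fv t"
| "pt_fv (TLam t) = unbind (pt_fv t)"
| "pt_fv (Pair t u) = pt_fv t \<union> pt_fv u"
| "pt_fv (Fst t) = pt_fv t"
| "pt_fv (Snd t) = pt_fv t"
| "pt_fv (InL t) = pt_fv t"
| "pt_fv (InR t) = pt_fv t"
| "pt_fv (Case t u v) = pt_fv t \<union> pt_fv u \<union> pt_fv v"
| "pt_fv (Wit m t) = tm_fv m \<union> pt_fv t"
| "pt_fv (Unpack t u) = pt_fv t \<union> unbind (pt_fv u)"
| "pt_fv (EM0 t u) = pt_fv t \<union> pt_fv u"
| "pt_fv (EM1 t u) = pt_fv t \<union> pt_fv u"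
| "pt_fv (HypA a A) = unbind (fm_fv A)"
| "pt_fv (HypW a A) = unbind (fm_fv A)"
| "pt_fv (HypZ A) = fm_fv A"

text \<open>The free occurrences of hypothesis variables in subterms \<open>HypA\<close> and \<open>HypW\<close> respectively,
  paired with the annotation found there (which is not relocated out of first-order binders).\<close>

definition unbind_occs :: "(nat \<times> 'c) set \<Rightarrow> (nat \<times> 'c) set" where
  "unbind_occs X = {(n, c). (Suc n, c) \<in> X}"

primrec hypA_occs :: "('f, 'p) pt \<Rightarrow> (nat \<times> ('f, 'p) fm) set" where
  "hypA_occs (PVar n) = {}"
| "hypA_occs (App t u) = hypA_occs t \<union> hypA_occs u"
| "hypA_occs (TApp t m) = hypA_occs t"
| "hypA_occs (Lam t) = hypA_occs t"
| "hypA_occs (TLam t) = hypA_occs t"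
| "hypA_occs (Pair t u) = hypA_occs t \<union> hypA_occs u"
| "hypA_occs (Fst t) = hypA_occs t"
| "hypA_occs (Snd t) = hypA_occs t"
| "hypA_occs (InL t) = hypA_occs t"
| "hypA_occs (InR t) = hypA_occs t"
| "hypA_occs (Case t u v) = hypA_occs t \<union> hypA_occs u \<union> hypA_occs v"
| "hypA_occs (Wit m t) = hypA_occs t"
| "hypA_occs (Unpack t u) = hypA_occs t \<union> hypA_occs u"
| "hypA_occs (EM0 t u) = hypA_occs t \<union> hypA_occs u"
| "hypA_occs (EM1 t u) = unbind_occs (hypA_occs t) \<union> unbind_occs (hypA_occs u)"
| "hypA_occs (HypA a A) = {(a, A)}"
| "hypA_occs (HypW a A) = {}"
| "hypA_occs (HypZ A) = {}"

primrec hypW_occs :: "('f, 'p) pt \<Rightarrow> (nat \<times> ('f, 'p) fm) set" where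
  "hypW_occs (PVar n) = {}"
| "hypW_occs (App t u) = hypW_occs t \<union> hypW_occs u"
| "hypW_occs (TApp t m) = hypW_occs t"
| "hypW_occs (Lam t) = hypW_occs t"
| "hypW_occs (TLam t) = hypW_occs t"
| "hypW_occs (Pair t u) = hypW_occs t \<union> hypW_occs u"
| "hypW_occs (Fst t) = hypW_occs t"
| "hypW_occs (Snd t) = hypW_occs t"
| "hypW_occs (InL t) = hypW_occs t"
| "hypW_occs (InR t) = hypW_occs t"
| "hypW_occs (Case t u v) = hypW_occs t \<union> hypW_occs u \<union> hypW_occs v"
| "hypW_occs (Wit m t) = hypW_occs t"
| "hypW_occs (Unpack t u) = hypW_occs t \<union> hypW_occs u"
| "hypW_occs (EM0 t u) = hypW_occs t \<union> hypW_occs u"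
| "hypW_occs (EM1 t u) = unbind_occs (hypW_occs t) \<union> unbind_occs (hypW_occs u)"
| "hypW_occs (HypA a A) = {}"
| "hypW_occs (HypW a A) = {(a, A)}"
| "hypW_occs (HypZ A) = {}"

definition pt_hv :: "('f, 'p) pt \<Rightarrow> nat set" where
  "pt_hv t = fst ` hypA_occs t \<union> fst ` hypW_occs t"

definition quasi_closed :: "('f, 'p) pt \<Rightarrow> bool" where
  "quasi_closed t \<longleftrightarrow> pt_pv t = {} \<and> pt_fv t = {} \<and> hypW_occs t = {} \<and>
     (\<exists>P. \<forall>(a, A) \<in> hypA_occs t. A = P a \<and> simply_universal (All A))"


section \<open>Substitutions\<close>

text \<open>First-order substitution.\<close>

primrec pt_fsubst :: "(nat \<Rightarrow> 'f tm) \<Rightarrow> ('f, 'p) pt \<Rightarrow> ('f, 'p) pt" where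
  "pt_fsubst \<sigma> (PVar n) = PVar n"
| "pt_fsubst \<sigma> (App t u) = App (pt_fsubst \<sigma> t) (pt_fsubst \<sigma> u)"
| "pt_fsubst \<sigma> (TApp t m) = TApp (pt_fsubst \<sigma> t) (tm_subst \<sigma> m)"
| "pt_fsubst \<sigma> (Lam t) = Lam (pt_fsubst \<sigma> t)"
| "pt_fsubst \<sigma> (TLam t) = TLam (pt_fsubst (tm_up \<sigma>) t)"
| "pt_fsubst \<sigma> (Pair t u) = Pair (pt_fsubst \<sigma> t) (pt_fsubst \<sigma> u)"
| "pt_fsubst \<sigma> (Fst t) = Fst (pt_fsubst \<sigma> t)"
| "pt_fsubst \<sigma> (Snd t) = Snd (pt_fsubst \<sigma> t)"
| "pt_fsubst \<sigma> (InL t) = InL (pt_fsubst \<sigma> t)"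
| "pt_fsubst \<sigma> (InR t) = InR (pt_fsubst \<sigma> t)"
| "pt_fsubst \<sigma> (Case t u v) = Case (pt_fsubst \<sigma> t) (pt_fsubst \<sigma> u) (pt_fsubst \<sigma> v)"
| "pt_fsubst \<sigma> (Wit m t) = Wit (tm_subst \<sigma> m) (pt_fsubst \<sigma> t)"
| "pt_fsubst \<sigma> (Unpack t u) = Unpack (pt_fsubst \<sigma> t) (pt_fsubst (tm_up \<sigma>) u)"
| "pt_fsubst \<sigma> (EM0 t u) = EM0 (pt_fsubst \<sigma> t) (pt_fsubst \<sigma> u)"
| "pt_fsubst \<sigma> (EM1 t u) = EM1 (pt_fsubst \<sigma> t) (pt_fsubst \<sigma> u)"
| "pt_fsubst \<sigma> (HypA a A) = HypA a (fm_subst (tm_up \<sigma>) A)"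
| "pt_fsubst \<sigma> (HypW a A) = HypW a (fm_subst (tm_up \<sigma>) A)"
| "pt_fsubst \<sigma> (HypZ A) = HypZ (fm_subst \<sigma> A)"

definition pt_flift :: "('f, 'p) pt \<Rightarrow> ('f, 'p) pt" where
  "pt_flift = pt_fsubst (\<lambda>n. Var (Suc n))"

definition pt_finst :: "'f tm \<Rightarrow> ('f, 'p) pt \<Rightarrow> ('f, 'p) pt" where
  "pt_finst m = pt_fsubst (case_nat m Var)"

definition ren_up :: "(nat \<Rightarrow> nat) \<Rightarrow> nat \<Rightarrow> nat" where
  "ren_up r = case_nat 0 (\<lambda>n. Suc (r n))"

text \<open>Renaming of hypothesis variables.\<close>

primrec pt_hren :: "(nat \<Rightarrow> nat) \<Rightarrow> ('f, 'p) pt \<Rightarrow> ('f, 'p) pt" where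
  "pt_hren r (PVar n) = PVar n"
| "pt_hren r (App t u) = App (pt_hren r t) (pt_hren r u)"
| "pt_hren r (TApp t m) = TApp (pt_hren r t) m"
| "pt_hren r (Lam t) = Lam (pt_hren r t)"
| "pt_hren r (TLam t) = TLam (pt_hren r t)"
| "pt_hren r (Pair t u) = Pair (pt_hren r t) (pt_hren r u)"
| "pt_hren r (Fst t) = Fst (pt_hren r t)"
| "pt_hren r (Snd t) = Snd (pt_hren r t)"
| "pt_hren r (InL t) = InL (pt_hren r t)"
| "pt_hren r (InR t) = InR (pt_hren r t)"
| "pt_hren r (Case t u v) = Case (pt_hren r t) (pt_hren r u) (pt_hren r v)"
| "pt_hren r (Wit m t) = Wit m (pt_hren r t)"
| "pt_hren r (Unpack t u) = Unpack (pt_hren r t) (pt_hren r u)"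
| "pt_hren r (EM0 t u) = EM0 (pt_hren r t) (pt_hren r u)"
| "pt_hren r (EM1 t u) = EM1 (pt_hren (ren_up r) t) (pt_hren (ren_up r) u)"
| "pt_hren r (HypA a A) = HypA (r a) A"
| "pt_hren r (HypW a A) = HypW (r a) A"
| "pt_hren r (HypZ A) = HypZ A"

definition pt_hlift :: "('f, 'p) pt \<Rightarrow> ('f, 'p) pt" where
  "pt_hlift = pt_hren Suc"

text \<open>Moves a term out of a hypothesis binder; only used if the bound variable (index 0) is not
  free in the term.\<close>

definition pt_hdrop :: "('f, 'p) pt \<Rightarrow> ('f, 'p) pt" where
  "pt_hdrop = pt_hren (\<lambda>n. n - 1)"

text \<open>Renaming of proof variables, and substitution of proof terms for proof variables.\<close>

primrec pt_ren :: "(nat \<Rightarrow> nat) \<Rightarrow> ('f, 'p) pt \<Rightarrow> ('f, 'p) pt" where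
  "pt_ren r (PVar n) = PVar (r n)"
| "pt_ren r (App t u) = App (pt_ren r t) (pt_ren r u)"
| "pt_ren r (TApp t m) = TApp (pt_ren r t) m"
| "pt_ren r (Lam t) = Lam (pt_ren (ren_up r) t)"
| "pt_ren r (TLam t) = TLam (pt_ren r t)"
| "pt_ren r (Pair t u) = Pair (pt_ren r t) (pt_ren r u)"
| "pt_ren r (Fst t) = Fst (pt_ren r t)"
| "pt_ren r (Snd t) = Snd (pt_ren r t)"
| "pt_ren r (InL t) = InL (pt_ren r t)"
| "pt_ren r (InR t) = InR (pt_ren r t)"
| "pt_ren r (Case t u v) = Case (pt_ren r t) (pt_ren (ren_up r) u) (pt_ren (ren_up r) v)"
| "pt_ren r (Wit m t) = Wit m (pt_ren r t)"
| "pt_ren r (Unpack t u) = Unpack (pt_ren r t) (pt_ren (ren_up r) u)"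
| "pt_ren r (EM0 t u) = EM0 (pt_ren r t) (pt_ren r u)"
| "pt_ren r (EM1 t u) = EM1 (pt_ren r t) (pt_ren r u)"
| "pt_ren r (HypA a A) = HypA a A"
| "pt_ren r (HypW a A) = HypW a A"
| "pt_ren r (HypZ A) = HypZ A"

definition pt_up :: "(nat \<Rightarrow> ('f, 'p) pt) \<Rightarrow> nat \<Rightarrow> ('f, 'p) pt" where
  "pt_up \<sigma> = case_nat (PVar 0) (\<lambda>n. pt_ren Suc (\<sigma> n))"

primrec pt_subst :: "(nat \<Rightarrow> ('f, 'p) pt) \<Rightarrow> ('f, 'p) pt \<Rightarrow> ('f, 'p) pt" where
  "pt_subst \<sigma> (PVar n) = \<sigma> n"
| "pt_subst \<sigma> (App t u) = App (pt_subst \<sigma> t) (pt_subst \<sigma> u)"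
| "pt_subst \<sigma> (TApp t m) = TApp (pt_subst \<sigma> t) m"
| "pt_subst \<sigma> (Lam t) = Lam (pt_subst (pt_up \<sigma>) t)"
| "pt_subst \<sigma> (TLam t) = TLam (pt_subst (\<lambda>n. pt_flift (\<sigma> n)) t)"
| "pt_subst \<sigma> (Pair t u) = Pair (pt_subst \<sigma> t) (pt_subst \<sigma> u)"
| "pt_subst \<sigma> (Fst t) = Fst (pt_subst \<sigma> t)"
| "pt_subst \<sigma> (Snd t) = Snd (pt_subst \<sigma> t)"
| "pt_subst \<sigma> (InL t) = InL (pt_subst \<sigma> t)"
| "pt_subst \<sigma> (InR t) = InR (pt_subst \<sigma> t)"
| "pt_subst \<sigma> (Case t u v) =
     Case (pt_subst \<sigma> t) (pt_subst (pt_up \<sigma>) u) (pt_subst (pt_up \<sigma>) v)"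
| "pt_subst \<sigma> (Wit m t) = Wit m (pt_subst \<sigma> t)"
| "pt_subst \<sigma> (Unpack t u) =
     Unpack (pt_subst \<sigma> t) (pt_subst (pt_up (\<lambda>n. pt_flift (\<sigma> n))) u)"
| "pt_subst \<sigma> (EM0 t u) = EM0 (pt_subst \<sigma> t) (pt_subst \<sigma> u)"
| "pt_subst \<sigma> (EM1 t u) =
     EM1 (pt_subst (\<lambda>n. pt_hlift (\<sigma> n)) t) (pt_subst (\<lambda>n. pt_hlift (\<sigma> n)) u)"
| "pt_subst \<sigma> (HypA a A) = HypA a A"
| "pt_subst \<sigma> (HypW a A) = HypW a A"
| "pt_subst \<sigma> (HypZ A) = HypZ A"

definition pt_inst :: "('f, 'p) pt \<Rightarrow> ('f, 'p) pt \<Rightarrow> ('f, 'p) pt" where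
  "pt_inst u = pt_subst (case_nat u PVar)"

text \<open>Exception substitution \<open>t[a := m]\<close>: \<open>exc_subst_W\<close> acts on the subterms \<open>HypW a P\<close>,
  \<open>exc_subst_H\<close> on the subterms \<open>TApp (HypA a P) m\<close> (for this particular \<open>m\<close> only).
  Neither removes the index \<open>a\<close>.\<close>

primrec exc_subst_W :: "nat \<Rightarrow> 'f tm \<Rightarrow> ('f, 'p) pt \<Rightarrow> ('f, 'p) pt" where
  "exc_subst_W a m (PVar n) = PVar n"
| "exc_subst_W a m (App t u) = App (exc_subst_W a m t) (exc_subst_W a m u)"
| "exc_subst_W a m (TApp t l) = TApp (exc_subst_W a m t) l"
| "exc_subst_W a m (Lam t) = Lam (exc_subst_W a m t)"
| "exc_subst_W a m (TLam t) = TLam (exc_subst_W a (tm_lift m) t)"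
| "exc_subst_W a m (Pair t u) = Pair (exc_subst_W a m t) (exc_subst_W a m u)"
| "exc_subst_W a m (Fst t) = Fst (exc_subst_W a m t)"
| "exc_subst_W a m (Snd t) = Snd (exc_subst_W a m t)"
| "exc_subst_W a m (InL t) = InL (exc_subst_W a m t)"
| "exc_subst_W a m (InR t) = InR (exc_subst_W a m t)"
| "exc_subst_W a m (Case t u v) =
     Case (exc_subst_W a m t) (exc_subst_W a m u) (exc_subst_W a m v)"
| "exc_subst_W a m (Wit l t) = Wit l (exc_subst_W a m t)"
| "exc_subst_W a m (Unpack t u) = Unpack (exc_subst_W a m t) (exc_subst_W a (tm_lift m) u)"
| "exc_subst_W a m (EM0 t u) = EM0 (exc_subst_W a m t) (exc_subst_W a m u)"
| "exc_subst_W a m (EM1 t u) = EM1 (exc_subst_W (Suc a) m t) (exc_subst_W (Suc a) m u)"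
| "exc_subst_W a m (HypA b A) = HypA b A"
| "exc_subst_W a m (HypW b A) = (if b = a then Wit m (HypZ (fm_inst m A)) else HypW b A)"
| "exc_subst_W a m (HypZ A) = HypZ A"

primrec exc_subst_H :: "nat \<Rightarrow> 'f tm \<Rightarrow> ('f, 'p) pt \<Rightarrow> ('f, 'p) pt" where
  "exc_subst_H a m (PVar n) = PVar n"
| "exc_subst_H a m (App t u) = App (exc_subst_H a m t) (exc_subst_H a m u)"
| "exc_subst_H a m (TApp t l) =
     (case t of
        HypA b P \<Rightarrow> if b = a \<and> l = m then HypZ (fm_inst m P) else TApp (HypA b P) l
      | _ \<Rightarrow> TApp (exc_subst_H a m t) l)"
| "exc_subst_H a m (Lam t) = Lam (exc_subst_H a m t)"
| "exc_subst_H a m (TLam t) = TLam (exc_subst_H a (tm_lift m) t)"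
| "exc_subst_H a m (Pair t u) = Pair (exc_subst_H a m t) (exc_subst_H a m u)"
| "exc_subst_H a m (Fst t) = Fst (exc_subst_H a m t)"
| "exc_subst_H a m (Snd t) = Snd (exc_subst_H a m t)"
| "exc_subst_H a m (InL t) = InL (exc_subst_H a m t)"
| "exc_subst_H a m (InR t) = InR (exc_subst_H a m t)"
| "exc_subst_H a m (Case t u v) =
     Case (exc_subst_H a m t) (exc_subst_H a m u) (exc_subst_H a m v)"
| "exc_subst_H a m (Wit l t) = Wit l (exc_subst_H a m t)"
| "exc_subst_H a m (Unpack t u) = Unpack (exc_subst_H a m t) (exc_subst_H a (tm_lift m) u)"
| "exc_subst_H a m (EM0 t u) = EM0 (exc_subst_H a m t) (exc_subst_H a m u)"
| "exc_subst_H a m (EM1 t u) = EM1 (exc_subst_H (Suc a) m t) (exc_subst_H (Suc a) m u)"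
| "exc_subst_H a m (HypA b A) = HypA b A"
| "exc_subst_H a m (HypW b A) = HypW b A"
| "exc_subst_H a m (HypZ A) = HypZ A"

text \<open>All \<open>(P, m)\<close> such that \<open>TApp (HypA a P) m\<close> occurs in the term with \<open>a\<close> free; \<open>P\<close> and \<open>m\<close> are
  not relocated out of first-order binders.\<close>

primrec hyp_apps :: "nat \<Rightarrow> ('f, 'p) pt \<Rightarrow> (('f, 'p) fm \<times> 'f tm) set" where
  "hyp_apps a (PVar n) = {}"
| "hyp_apps a (App t u) = hyp_apps a t \<union> hyp_apps a u"
| "hyp_apps a (TApp t m) =
     (case t of HypA b P \<Rightarrow> if b = a then {(P, m)} else {} | _ \<Rightarrow> hyp_apps a t)"
| "hyp_apps a (Lam t) = hyp_apps a t"
| "hyp_apps a (TLam t) = hyp_apps a t"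
| "hyp_apps a (Pair t u) = hyp_apps a t \<union> hyp_apps a u"
| "hyp_apps a (Fst t) = hyp_apps a t"
| "hyp_apps a (Snd t) = hyp_apps a t"
| "hyp_apps a (InL t) = hyp_apps a t"
| "hyp_apps a (InR t) = hyp_apps a t"
| "hyp_apps a (Case t u v) = hyp_apps a t \<union> hyp_apps a u \<union> hyp_apps a v"
| "hyp_apps a (Wit m t) = hyp_apps a t"
| "hyp_apps a (Unpack t u) = hyp_apps a t \<union> hyp_apps a u"
| "hyp_apps a (EM0 t u) = hyp_apps a t \<union> hyp_apps a u"
| "hyp_apps a (EM1 t u) = hyp_apps (Suc a) t \<union> hyp_apps (Suc a) u"
| "hyp_apps a (HypA b A) = {}"
| "hyp_apps a (HypW b A) = {}"
| "hyp_apps a (HypZ A) = {}"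

text \<open>The term has an active subterm \<open>TApp (HypA a P) m\<close>, i.e. one without free first-order
  variables.\<close>

definition has_active :: "nat \<Rightarrow> ('f, 'p) fm \<Rightarrow> 'f tm \<Rightarrow> ('f, 'p) pt \<Rightarrow> bool" where
  "has_active a P m t \<longleftrightarrow> (P, m) \<in> hyp_apps a t \<and> pt_fv (TApp (HypA a P) m) = {}"


section \<open>Typing\<close>

text \<open>
  In \<open>typed L \<Gamma> \<Delta> t A\<close> the list \<open>\<Gamma>\<close> contains the formulas of the proof variables and \<open>\<Delta>\<close> those of
  the hypothesis variables, position \<open>i\<close> belonging to index \<open>i\<close>. The hypothesis introduced by \<open>EM0\<close>
  is not bound in the term, so it is put at the end of \<open>\<Delta>\<close>, where it does not shift the indices of
  the other hypotheses; it is a negative propositional formula and can be used only through \<open>HypZ\<close>,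
  which does not mention the index. First-order eigenvariable conditions are expressed by
  \<open>fm_lift\<close>. The conditions \<open>tm_over\<close>, \<open>fm_over\<close> keep all expressions within the language, provided
  that the formulas in \<open>\<Gamma>\<close> and \<open>\<Delta>\<close> belong to it.
\<close>

inductive typed ::
  "('f, 'p) lang \<Rightarrow> ('f, 'p) fm list \<Rightarrow> ('f, 'p) fm list \<Rightarrow> ('f, 'p) pt \<Rightarrow> ('f, 'p) fm \<Rightarrow> bool"
  for L :: "('f, 'p) lang" where
  PVar: "i < length \<Gamma> \<Longrightarrow> typed L \<Gamma> \<Delta> (PVar i) (\<Gamma> ! i)"
| Pair: "typed L \<Gamma> \<Delta> u A \<Longrightarrow> typed L \<Gamma> \<Delta> t B \<Longrightarrow> typed L \<Gamma> \<Delta> (Pair u t) (And A B)"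
| Fst: "typed L \<Gamma> \<Delta> u (And A B) \<Longrightarrow> typed L \<Gamma> \<Delta> (Fst u) A"
| Snd: "typed L \<Gamma> \<Delta> u (And A B) \<Longrightarrow> typed L \<Gamma> \<Delta> (Snd u) B"
| App: "typed L \<Gamma> \<Delta> t (Imp A B) \<Longrightarrow> typed L \<Gamma> \<Delta> u A \<Longrightarrow> typed L \<Gamma> \<Delta> (App t u) B"
| Lam: "fm_over L A \<Longrightarrow> typed L (A # \<Gamma>) \<Delta> u B \<Longrightarrow> typed L \<Gamma> \<Delta> (Lam u) (Imp A B)"
| InL: "fm_over L B \<Longrightarrow> typed L \<Gamma> \<Delta> u A \<Longrightarrow> typed L \<Gamma> \<Delta> (InL u) (Or A B)"
| InR: "fm_over L A \<Longrightarrow> typed L \<Gamma> \<Delta> u B \<Longrightarrow> typed L \<Gamma> \<Delta> (InR u) (Or A B)"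
| Case: "typed L \<Gamma> \<Delta> u (Or A B) \<Longrightarrow> typed L (A # \<Gamma>) \<Delta> w1 C \<Longrightarrow> typed L (B # \<Gamma>) \<Delta> w2 C \<Longrightarrow>
     typed L \<Gamma> \<Delta> (Case u w1 w2) C"
| TApp: "tm_over L m \<Longrightarrow> typed L \<Gamma> \<Delta> u (All A) \<Longrightarrow> typed L \<Gamma> \<Delta> (TApp u m) (fm_inst m A)"
| TLam: "typed L (map fm_lift \<Gamma>) (map fm_lift \<Delta>) u A \<Longrightarrow> typed L \<Gamma> \<Delta> (TLam u) (All A)"
| Wit: "tm_over L m \<Longrightarrow> typed L \<Gamma> \<Delta> u (fm_inst m A) \<Longrightarrow> typed L \<Gamma> \<Delta> (Wit m u) (Ex A)"
| Unpack: "typed L \<Gamma> \<Delta> u (Ex A) \<Longrightarrow>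
     typed L (A # map fm_lift \<Gamma>) (map fm_lift \<Delta>) t (fm_lift C) \<Longrightarrow>
     typed L \<Gamma> \<Delta> (Unpack u t) C"
| HypA: "a < length \<Delta> \<Longrightarrow> \<Delta> ! a = All A \<Longrightarrow> neg_prop A \<or> simply_universal A \<Longrightarrow>
     typed L \<Gamma> \<Delta> (HypA a A) (All A)"
| HypW: "a < length \<Delta> \<Longrightarrow> \<Delta> ! a = Ex P \<Longrightarrow> neg_prop P \<Longrightarrow> typed L \<Gamma> \<Delta> (HypW a P) (Ex P)"
| HypZ: "P \<in> set \<Delta> \<Longrightarrow> neg_prop P \<Longrightarrow> typed L \<Gamma> \<Delta> (HypZ P) P"
| HypZ_Bot: "fm_over L P \<Longrightarrow> neg_prop P \<Longrightarrow> typed L \<Gamma> \<Delta> (HypZ (Imp Bot P)) (Imp Bot P)"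
| EM0: "fm_over L P \<Longrightarrow> neg_prop P \<Longrightarrow>
     typed L \<Gamma> (\<Delta> @ [Neg P]) u C \<Longrightarrow> typed L \<Gamma> (\<Delta> @ [P]) v C \<Longrightarrow> typed L \<Gamma> \<Delta> (EM0 u v) C"
| EM1: "fm_over L P \<Longrightarrow> neg_prop P \<Longrightarrow> neg_prop Q \<Longrightarrow>
     typed L \<Gamma> (All P # \<Delta>) u (Ex Q) \<Longrightarrow> typed L \<Gamma> (Ex (Neg P) # \<Delta>) v (Ex Q) \<Longrightarrow>
     typed L \<Gamma> \<Delta> (EM1 u v) (Ex Q)"


section \<open>Reduction and Herbrand normal forms\<close>

inductive red :: "('f, 'p) pt \<Rightarrow> ('f, 'p) pt \<Rightarrow> bool" (infix \<open>\<mapsto>\<close> 50) where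
  beta: "App (Lam u) t \<mapsto> pt_inst t u"
| tbeta: "TApp (TLam u) m \<mapsto> pt_finst m u"
| fst_pair: "Fst (Pair u v) \<mapsto> u"
| snd_pair: "Snd (Pair u v) \<mapsto> v"
| case_inl: "Case (InL u) t0 t1 \<mapsto> pt_inst u t0"
| case_inr: "Case (InR u) t0 t1 \<mapsto> pt_inst u t1"
| unpack_wit: "Unpack (Wit m u) v \<mapsto> pt_inst u (pt_finst m v)"
| perm_app: "App (EM0 u v) w \<mapsto> EM0 (App u w) (App v w)"
| perm_tapp: "TApp (EM0 u v) m \<mapsto> EM0 (TApp u m) (TApp v m)"
| perm_fst: "Fst (EM0 u v) \<mapsto> EM0 (Fst u) (Fst v)"
| perm_snd: "Snd (EM0 u v) \<mapsto> EM0 (Snd u) (Snd v)"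
| perm_case: "Case (EM0 u v) w1 w2 \<mapsto> EM0 (Case u w1 w2) (Case v w1 w2)"
| perm_unpack: "Unpack (EM0 u v) w \<mapsto> EM0 (Unpack u w) (Unpack v w)"
| em1_drop: "0 \<notin> pt_hv u \<Longrightarrow> EM1 u v \<mapsto> pt_hdrop u"
| em1_raise: "has_active 0 P m u \<Longrightarrow>
     EM1 u v \<mapsto> EM0 (pt_hdrop (exc_subst_W 0 m v)) (EM1 (exc_subst_H 0 m u) v)"
| App1: "t \<mapsto> t' \<Longrightarrow> App t u \<mapsto> App t' u"
| App2: "u \<mapsto> u' \<Longrightarrow> App t u \<mapsto> App t u'"
| TApp1: "t \<mapsto> t' \<Longrightarrow> TApp t m \<mapsto> TApp t' m"
| Lam1: "t \<mapsto> t' \<Longrightarrow> Lam t \<mapsto> Lam t'"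
| TLam1: "t \<mapsto> t' \<Longrightarrow> TLam t \<mapsto> TLam t'"
| Pair1: "t \<mapsto> t' \<Longrightarrow> Pair t u \<mapsto> Pair t' u"
| Pair2: "u \<mapsto> u' \<Longrightarrow> Pair t u \<mapsto> Pair t u'"
| Fst1: "t \<mapsto> t' \<Longrightarrow> Fst t \<mapsto> Fst t'"
| Snd1: "t \<mapsto> t' \<Longrightarrow> Snd t \<mapsto> Snd t'"
| InL1: "t \<mapsto> t' \<Longrightarrow> InL t \<mapsto> InL t'"
| InR1: "t \<mapsto> t' \<Longrightarrow> InR t \<mapsto> InR t'"
| Case1: "t \<mapsto> t' \<Longrightarrow> Case t u v \<mapsto> Case t' u v"
| Case2: "u \<mapsto> u' \<Longrightarrow> Case t u v \<mapsto> Case t u' v"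
| Case3: "v \<mapsto> v' \<Longrightarrow> Case t u v \<mapsto> Case t u v'"
| Wit1: "t \<mapsto> t' \<Longrightarrow> Wit m t \<mapsto> Wit m t'"
| Unpack1: "t \<mapsto> t' \<Longrightarrow> Unpack t u \<mapsto> Unpack t' u"
| Unpack2: "u \<mapsto> u' \<Longrightarrow> Unpack t u \<mapsto> Unpack t u'"
| EM0_1: "t \<mapsto> t' \<Longrightarrow> EM0 t u \<mapsto> EM0 t' u"
| EM0_2: "u \<mapsto> u' \<Longrightarrow> EM0 t u \<mapsto> EM0 t u'"
| EM1_1: "t \<mapsto> t' \<Longrightarrow> EM1 t u \<mapsto> EM1 t' u"
| EM1_2: "u \<mapsto> u' \<Longrightarrow> EM1 t u \<mapsto> EM1 t u'"

abbreviation reds :: "('f, 'p) pt \<Rightarrow> ('f, 'p) pt \<Rightarrow> bool" (infix \<open>\<mapsto>\<^sup>*\<close> 50) where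
  "t \<mapsto>\<^sup>* t' \<equiv> red\<^sup>*\<^sup>* t t'"

definition normal :: "('f, 'p) pt \<Rightarrow> bool" where
  "normal t \<longleftrightarrow> (\<nexists>t'. t \<mapsto> t')"

inductive herbrand_nf :: "('f, 'p) pt \<Rightarrow> bool" where
  "normal (Wit m u) \<Longrightarrow> herbrand_nf (Wit m u)"
| "herbrand_nf u \<Longrightarrow> herbrand_nf v \<Longrightarrow> herbrand_nf (EM0 u v)"

text \<open>The pairs \<open>(m\<^sub>0, u\<^sub>0), \<dots>, (m\<^sub>k, u\<^sub>k)\<close> from which a Herbrand normal form is built,
  from left to right (only meaningful for Herbrand normal forms).\<close>

fun components :: "('f, 'p) pt \<Rightarrow> ('f tm \<times> ('f, 'p) pt) list" where
  "components (Wit m u) = [(m, u)]"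
| "components (EM0 u v) = components u @ components v"
| "components _ = []"

text \<open>\<open>(\<dots>(A\<^sub>0 \<or> A\<^sub>1) \<or> \<dots>) \<or> A\<^sub>k\<close>\<close>

definition big_or :: "('f, 'p) fm list \<Rightarrow> ('f, 'p) fm" where
  "big_or As = foldl Or (hd As) (tl As)"

end

theory Submission
  imports Defs
begin

text \<open>
  Reduction preserves types, and by strengthening the contexts first it also preserves the absence
  of proof variables and of free \<open>W\<close> hypotheses. In a closed normal term, every
  elimination whose head is not a redex starts from a hypothesis, so its type is simply universal;
  hence \<open>Case\<close> and \<open>Unpack\<close> cannot occur at the top. Neither can \<open>EM1 u v\<close>: its conclusion
  \<open>\<exists>\<beta> Q\<close> has negative propositional \<open>Q\<close>, so every hypothesis in the Herbrand normal form
  \<open>u\<close> is active, and either the bound one occurs and \<open>em1_raise\<close> applies, or it does not and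
  \<open>em1_drop\<close> applies. A normal proof of an existential formula is therefore built from witnesses by
  \<open>EM0\<close>, and replacing each witness by an injection into the disjunction, while keeping
  the \<open>EM0\<close> structure, proves the Herbrand disjunction.
\<close>

section \<open>Substitution algebra\<close>

text \<open>Free variables are bounded by initial segments: passing under a binder raises the bound
  by one, and bound 0 means closed.\<close>

lemma unbind_subset_iff [simp]: "unbind X \<subseteq> {..<k} \<longleftrightarrow> X \<subseteq> {..<Suc k}"
  unfolding unbind_def subset_eq by (auto simp: less_Suc_eq_0_disj gr0_conv_Suc) (metis not0_implies_Suc)

lemma tm_subst_cong: "(\<And>n. n \<in> tm_fv m \<Longrightarrow> \<sigma> n = \<tau> n) \<Longrightarrow> tm_subst \<sigma> m = tm_subst \<tau> m"
  by (induction m) auto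

lemma tm_subst_comp: "tm_subst \<sigma> (tm_subst \<tau> m) = tm_subst (\<lambda>n. tm_subst \<sigma> (\<tau> n)) m"
  by (induction m) auto

lemma tm_subst_Var [simp]: "tm_subst Var m = m"
  by (induction m) (auto simp: map_idI)

lemma tm_up_simps [simp]: "tm_up \<sigma> 0 = Var 0" "tm_up \<sigma> (Suc n) = tm_lift (\<sigma> n)"
  by (simp_all add: tm_up_def)

lemma tm_up_Var [simp]: "tm_up Var = Var"
  by (rule ext) (simp add: tm_up_def tm_lift_def split: nat.split)

lemma tm_subst_up_lift: "tm_subst (tm_up \<sigma>) (tm_lift m) = tm_lift (tm_subst \<sigma> m)"
  by (simp add: tm_lift_def tm_subst_comp)

lemma tm_up_comp: "tm_up (\<lambda>n. tm_subst \<sigma> (\<tau> n)) = (\<lambda>n. tm_subst (tm_up \<sigma>) (tm_up \<tau> n))"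
  by (rule ext) (simp add: tm_up_def tm_subst_up_lift[unfolded tm_up_def] split: nat.split)

lemma tm_up_cong:
  "(\<And>n. n \<in> unbind X \<Longrightarrow> \<sigma> n = \<tau> n) \<Longrightarrow> n \<in> X \<Longrightarrow> tm_up \<sigma> n = tm_up \<tau> n"
  by (cases n) (auto simp: unbind_def)

lemma fm_subst_cong: "(\<And>n. n \<in> fm_fv A \<Longrightarrow> \<sigma> n = \<tau> n) \<Longrightarrow> fm_subst \<sigma> A = fm_subst \<tau> A"
proof (induction A arbitrary: \<sigma> \<tau>)
  case (Atom p ts)
  then show ?case by (auto intro!: tm_subst_cong)
next
  case (All A)
  have "fm_subst (tm_up \<sigma>) A = fm_subst (tm_up \<tau>) A"
    by (rule All.IH, rule tm_up_cong[of "fm_fv A"]) (use All.prems in auto)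
  then show ?case by simp
next
  case (Ex A)
  have "fm_subst (tm_up \<sigma>) A = fm_subst (tm_up \<tau>) A"
    by (rule Ex.IH, rule tm_up_cong[of "fm_fv A"]) (use Ex.prems in auto)
  then show ?case by simp
next
  case (And A B)
  have "fm_subst \<sigma> A = fm_subst \<tau> A" "fm_subst \<sigma> B = fm_subst \<tau> B"
    using And.prems by (auto intro: And.IH)
  then show ?case by simp
next
  case (Or A B)
  have "fm_subst \<sigma> A = fm_subst \<tau> A" "fm_subst \<sigma> B = fm_subst \<tau> B"
    using Or.prems by (auto intro: Or.IH)
  then show ?case by simp
next
  case (Imp A B)
  have "fm_subst \<sigma> A = fm_subst \<tau> A" "fm_subst \<sigma> B = fm_subst \<tau> B"
    using Imp.prems by (auto intro: Imp.IH)
  then show ?case by simp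
qed simp

lemma fm_subst_comp: "fm_subst \<sigma> (fm_subst \<tau> A) = fm_subst (\<lambda>n. tm_subst \<sigma> (\<tau> n)) A"
  by (induction A arbitrary: \<sigma> \<tau>) (auto simp: tm_subst_comp tm_up_comp)

lemma fm_subst_Var [simp]: "fm_subst Var A = A"
  by (induction A) (auto simp: map_idI)

lemma fm_subst_up_lift [simp]: "fm_subst (tm_up \<sigma>) (fm_lift A) = fm_lift (fm_subst \<sigma> A)"
  by (simp add: fm_lift_def fm_subst_comp tm_lift_def)

lemma fm_inst_lift [simp]: "fm_inst m (fm_lift A) = A"
  by (simp add: fm_inst_def fm_lift_def fm_subst_comp)

lemma tm_inst_lift [simp]: "tm_subst (case_nat m Var) (tm_lift l) = l"
  by (simp add: tm_lift_def tm_subst_comp)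

lemma fm_subst_inst: "fm_subst \<sigma> (fm_inst m A) = fm_inst (tm_subst \<sigma> m) (fm_subst (tm_up \<sigma>) A)"
  unfolding fm_inst_def fm_subst_comp
  by (rule fm_subst_cong) (simp split: nat.split)

lemma tm_lift_closed: "tm_fv m = {} \<Longrightarrow> tm_lift m = m"
  unfolding tm_lift_def using tm_subst_cong[of m _ Var] by auto

lemma fm_lift_closed: "fm_fv A = {} \<Longrightarrow> fm_lift A = A"
  unfolding fm_lift_def using fm_subst_cong[of A _ Var] by auto

text \<open>A closed lift is fixed by a further lift; instantiating both sides of that equation
  strips one lift from each. This carries a closed hypothesis found under a first-order binder back
  outside.\<close>

lemma fm_lift_fv_empty: "fm_fv (fm_lift A) = {} \<Longrightarrow> fm_lift A = A"
  using fm_inst_lift fm_inst_def by (metis fm_lift_def fm_lift_closed)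

lemma neg_prop_subst [simp]: "neg_prop (fm_subst \<sigma> A) = neg_prop A"
  by (induction A arbitrary: \<sigma>) auto

lemma neg_prop_lift [simp]: "neg_prop (fm_lift A) = neg_prop A"
  by (simp add: fm_lift_def)

lemma neg_prop_inst [simp]: "neg_prop (fm_inst m A) = neg_prop A"
  by (simp add: fm_inst_def)

section \<open>Simply universal formulas\<close>

lemma neg_prop_simply_universal: "neg_prop A \<Longrightarrow> simply_universal A"
  unfolding simply_universal_def by (metis funpow_0)

lemma simply_universal_All [simp]: "simply_universal (All A) \<longleftrightarrow> simply_universal A"
proof
  assume "simply_universal (All A)"
  then obtain k P where P: "neg_prop P" "All A = (All ^^ k) P"
    by (auto simp: simply_universal_def)
  then show "simply_universal A"
    by (cases k) (auto simp: simply_universal_def)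
next
  assume "simply_universal A"
  then obtain k P where "neg_prop P" "A = (All ^^ k) P"
    by (auto simp: simply_universal_def)
  then have "All A = (All ^^ Suc k) P" by simp
  then show "simply_universal (All A)"
    using \<open>neg_prop P\<close> unfolding simply_universal_def by blast
qed

text \<open>Splits on whether the prefix is empty. Thus a simply universal \<open>And\<close> or
  \<open>Imp\<close> is negative propositional, and an \<open>Or\<close> or \<open>Ex\<close> is
  never simply universal.\<close>

lemma simply_universal_cases:
  assumes "simply_universal A"
  shows "neg_prop A \<or> (\<exists>B. A = All B)"
proof -
  obtain k P where "neg_prop P" "A = (All ^^ k) P"
    using assms by (auto simp: simply_universal_def)
  then show ?thesis by (cases k) auto
qed

text \<open>\<open>\<tau>\<close> is \<open>\<sigma>\<close> pushed under the \<open>k\<close>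
  quantifiers; its existence suffices because \<open>neg_prop\<close> is stable under every
  substitution.\<close>

lemma fm_subst_All_funpow: "\<exists>\<tau>. fm_subst \<sigma> ((All ^^ k) P) = (All ^^ k) (fm_subst \<tau> P)"
  by (induction k arbitrary: \<sigma>) auto

lemma simply_universal_subst: "simply_universal A \<Longrightarrow> simply_universal (fm_subst \<sigma> A)"
  unfolding simply_universal_def using fm_subst_All_funpow neg_prop_subst by metis

lemma simply_universal_inst: "simply_universal A \<Longrightarrow> simply_universal (fm_inst m A)"
  by (simp add: fm_inst_def simply_universal_subst)

section \<open>Staying inside the language\<close>

lemma tm_over_subst: "(\<And>n. tm_over L (\<sigma> n)) \<Longrightarrow> tm_over L m \<Longrightarrow> tm_over L (tm_subst \<sigma> m)"
  by (induction m) (auto simp: list_all_iff)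

lemma tm_over_up: "(\<And>n. tm_over L (\<sigma> n)) \<Longrightarrow> tm_over L (tm_up \<sigma> n)"
  by (cases n) (auto simp: tm_lift_def intro: tm_over_subst)

lemma fm_over_subst: "(\<And>n. tm_over L (\<sigma> n)) \<Longrightarrow> fm_over L A \<Longrightarrow> fm_over L (fm_subst \<sigma> A)"
  by (induction A arbitrary: \<sigma>) (auto simp: list_all_iff intro: tm_over_subst tm_over_up)

lemma fm_over_inst: "tm_over L m \<Longrightarrow> fm_over L A \<Longrightarrow> fm_over L (fm_inst m A)"
  unfolding fm_inst_def by (rule fm_over_subst) (auto split: nat.split)

lemma fm_lift_eq_All: "fm_lift B = All A \<Longrightarrow> \<exists>A'. B = All A'"
  by (cases B) (auto simp: fm_lift_def)

lemma fm_lift_eq_Ex: "fm_lift B = Ex A \<Longrightarrow> \<exists>A'. B = Ex A'"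
  by (cases B) (auto simp: fm_lift_def)


section \<open>Structural properties of typing\<close>

lemma ren_up_simps [simp]: "ren_up r 0 = 0" "ren_up r (Suc n) = Suc (r n)"
  by (simp_all add: ren_up_def)

lemma ren_up_id [simp]: "ren_up (\<lambda>n. n) = (\<lambda>n. n)"
  by (rule ext) (simp add: ren_up_def split: nat.split)

lemma pt_hren_id [simp]: "pt_hren (\<lambda>n. n) t = t"
  by (induction t) auto

lemma pt_ren_id [simp]: "pt_ren (\<lambda>n. n) t = t"
  by (induction t) auto

lemma pt_hv_simps [simp]:
  "pt_hv (PVar n) = {}" "pt_hv (App t u) = pt_hv t \<union> pt_hv u" "pt_hv (TApp t m) = pt_hv t"
  "pt_hv (Lam t) = pt_hv t" "pt_hv (TLam t) = pt_hv t" "pt_hv (Pair t u) = pt_hv t \<union> pt_hv u"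
  "pt_hv (Fst t) = pt_hv t" "pt_hv (Snd t) = pt_hv t" "pt_hv (InL t) = pt_hv t"
  "pt_hv (InR t) = pt_hv t" "pt_hv (Case t u v) = pt_hv t \<union> pt_hv u \<union> pt_hv v"
  "pt_hv (Wit m t) = pt_hv t" "pt_hv (Unpack t u) = pt_hv t \<union> pt_hv u"
  "pt_hv (EM0 t u) = pt_hv t \<union> pt_hv u"
  "pt_hv (HypA a A) = {a}" "pt_hv (HypW a A) = {a}" "pt_hv (HypZ A) = {}"
  by (auto simp: pt_hv_def)

lemma pt_hv_EM1 [simp]: "pt_hv (EM1 t u) = unbind (pt_hv t) \<union> unbind (pt_hv u)"
  by (force simp: pt_hv_def unbind_def unbind_occs_def)

text \<open>Negative propositional hypotheses are never referred to by their index, hence only the other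
  ones must be respected by the renaming.\<close>

lemma typed_hren:
  assumes "typed L \<Gamma> \<Delta> t A"
    and "\<And>a. a \<in> pt_hv t \<Longrightarrow> a < length \<Delta> \<Longrightarrow> \<not> neg_prop (\<Delta> ! a) \<Longrightarrow>
      r a < length \<Delta>' \<and> \<Delta>' ! r a = \<Delta> ! a"
    and "\<And>P. P \<in> set \<Delta> \<Longrightarrow> neg_prop P \<Longrightarrow> P \<in> set \<Delta>'"
  shows "typed L \<Gamma> \<Delta>' (pt_hren r t) A"
  using assms
proof (induction arbitrary: r \<Delta>' rule: typed.induct)
  case (TLam \<Gamma> \<Delta> u A)
  have "typed L (map fm_lift \<Gamma>) (map fm_lift \<Delta>') (pt_hren r u) A"
    by (rule TLam.IH) (use TLam.prems in auto)
  then show ?case by (auto intro: typed.TLam)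
next
  case (Unpack \<Gamma> \<Delta> u A t C)
  have "typed L \<Gamma> \<Delta>' (pt_hren r u) (Ex A)"
    by (rule Unpack.IH) (use Unpack.prems in auto)
  moreover have "typed L (A # map fm_lift \<Gamma>) (map fm_lift \<Delta>') (pt_hren r t) (fm_lift C)"
    by (rule Unpack.IH) (use Unpack.prems in auto)
  ultimately show ?case by (auto intro: typed.Unpack)
next
  case (EM0 P \<Gamma> \<Delta> u C v)
  \<comment> \<open>The hypothesis appended by \<open>EM0\<close> may land at another index, since
    \<open>\<Delta>'\<close> may differ in length. Being negative propositional, it is used by
    membership through \<open>HypZ\<close>, so its index is exempt.\<close>
  have *: "neg_prop X \<Longrightarrow> a \<in> pt_hv u \<union> pt_hv v \<Longrightarrow> a < length (\<Delta> @ [X]) \<Longrightarrow> \<not> neg_prop ((\<Delta> @ [X]) ! a)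
      \<Longrightarrow> r a < length (\<Delta>' @ [X]) \<and> (\<Delta>' @ [X]) ! r a = (\<Delta> @ [X]) ! a" for X a
    using EM0.prems(1)[of a] by (auto simp: nth_append less_Suc_eq split: if_splits)
  have "typed L \<Gamma> (\<Delta>' @ [Neg P]) (pt_hren r u) C"
    by (rule EM0.IH(1), rule *) (use EM0.hyps EM0.prems(2) in auto)
  moreover have "typed L \<Gamma> (\<Delta>' @ [P]) (pt_hren r v) C"
    by (rule EM0.IH(2), rule *) (use EM0.hyps EM0.prems(2) in auto)
  ultimately show ?case using EM0.hyps by (auto intro: typed.EM0)
next
  case (EM1 P Q \<Gamma> \<Delta> u v)
  have *: "a \<in> pt_hv u \<union> pt_hv v \<Longrightarrow> a < length (X # \<Delta>) \<Longrightarrow> \<not> neg_prop ((X # \<Delta>) ! a)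
      \<Longrightarrow> ren_up r a < length (X # \<Delta>') \<and> (X # \<Delta>') ! ren_up r a = (X # \<Delta>) ! a" for X a
    using EM1.prems(1)[of "a - 1"] by (cases a) (auto simp: unbind_def)
  have "typed L \<Gamma> (All P # \<Delta>') (pt_hren (ren_up r) u) (Ex Q)"
    by (rule EM1.IH(1), rule *) (use EM1.prems(2) in auto)
  moreover have "typed L \<Gamma> (Ex (Neg P) # \<Delta>') (pt_hren (ren_up r) v) (Ex Q)"
    by (rule EM1.IH(2), rule *) (use EM1.prems(2) in auto)
  ultimately show ?case using EM1.hyps by (auto intro: typed.EM1)
next
  case (Case \<Gamma> \<Delta> u A B w1 C w2)
  have "typed L \<Gamma> \<Delta>' (pt_hren r u) (Or A B)" "typed L (A # \<Gamma>) \<Delta>' (pt_hren r w1) C"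
    "typed L (B # \<Gamma>) \<Delta>' (pt_hren r w2) C"
    by (rule Case.IH; use Case.prems in auto)+
  then show ?case by (auto intro: typed.Case)
next
  case (App \<Gamma> \<Delta> t A B u)
  have "typed L \<Gamma> \<Delta>' (pt_hren r t) (Imp A B)" "typed L \<Gamma> \<Delta>' (pt_hren r u) A"
    by (rule App.IH; use App.prems in auto)+
  then show ?case by (auto intro: typed.App)
next
  case (HypA a \<Delta> A \<Gamma>)
  then show ?case using HypA.prems(1)[of a] by (auto intro: typed.HypA)
next
  case (HypW a \<Delta> A \<Gamma>)
  then show ?case using HypW.prems(1)[of a] by (auto intro: typed.HypW)
qed (auto intro: typed.intros)

lemma typed_weaken_hyps: "typed L \<Gamma> \<Delta> t A \<Longrightarrow> typed L \<Gamma> (\<Delta> @ \<Delta>') t A"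
  using typed_hren[of L \<Gamma> \<Delta> t A "\<lambda>n. n" "\<Delta> @ \<Delta>'"] by (auto simp: nth_append)

lemma typed_hlift: "typed L \<Gamma> \<Delta> t A \<Longrightarrow> typed L \<Gamma> (B # \<Delta>) (pt_hlift t) A"
  unfolding pt_hlift_def by (rule typed_hren) auto

text \<open>Absence of index 0 from \<open>pt_hv\<close> excludes uses of \<open>B\<close> by
  \<open>HypA\<close> and \<open>HypW\<close>, but \<open>HypZ\<close> could still use
  \<open>B\<close> by membership; requiring that \<open>B\<close> is not negative propositional
  closes this gap.\<close>

lemma typed_hdrop:
  assumes "typed L \<Gamma> (B # \<Delta>) t A" "0 \<notin> pt_hv t" "\<not> neg_prop B"
  shows "typed L \<Gamma> \<Delta> (pt_hdrop t) A"
  unfolding pt_hdrop_def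
proof (rule typed_hren[OF assms(1)])
  fix a assume "a \<in> pt_hv t" "a < length (B # \<Delta>)"
  then show "a - 1 < length \<Delta> \<and> \<Delta> ! (a - 1) = (B # \<Delta>) ! a"
    using assms(2) by (cases a) auto
qed (use assms(3) in auto)

text \<open>Only variables that occur must keep their formula, so a term without free proof
  variables can be retyped in the empty context by the identity renaming.\<close>

lemma typed_ren:
  assumes "typed L \<Gamma> \<Delta> t A"
    and "\<And>i. i \<in> pt_pv t \<Longrightarrow> i < length \<Gamma> \<Longrightarrow> r i < length \<Gamma>' \<and> \<Gamma>' ! r i = \<Gamma> ! i"
  shows "typed L \<Gamma>' \<Delta> (pt_ren r t) A"
  using assms
proof (induction arbitrary: r \<Gamma>' rule: typed.induct)
  case (PVar i \<Gamma> \<Delta>)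
  then show ?case using typed.PVar[of "r i" \<Gamma>' L \<Delta>] by simp
next
  case (App \<Gamma> \<Delta> t A B u)
  have "typed L \<Gamma>' \<Delta> (pt_ren r t) (Imp A B)" "typed L \<Gamma>' \<Delta> (pt_ren r u) A"
    by (rule App.IH; use App.prems in auto)+
  then show ?case by (auto intro: typed.App)
next
  case (Lam A \<Gamma> \<Delta> u B)
  have "typed L (A # \<Gamma>') \<Delta> (pt_ren (ren_up r) u) B"
  proof (rule Lam.IH)
    fix i assume "i \<in> pt_pv u" "i < length (A # \<Gamma>)"
    then show "ren_up r i < length (A # \<Gamma>') \<and> (A # \<Gamma>') ! ren_up r i = (A # \<Gamma>) ! i"
      using Lam.prems[of "i - 1"] by (cases i) (auto simp: unbind_def)
  qed
  with Lam.hyps show ?case by (auto intro: typed.Lam)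
next
  case (Case \<Gamma> \<Delta> u A B w1 C w2)
  have *: "i \<in> pt_pv w1 \<union> pt_pv w2 \<Longrightarrow> i < length (X # \<Gamma>) \<Longrightarrow>
      ren_up r i < length (X # \<Gamma>') \<and> (X # \<Gamma>') ! ren_up r i = (X # \<Gamma>) ! i" for X i
    using Case.prems[of "i - 1"] by (cases i) (auto simp: unbind_def)
  have "typed L \<Gamma>' \<Delta> (pt_ren r u) (Or A B)"
    by (rule Case.IH) (use Case.prems in auto)
  moreover have "typed L (A # \<Gamma>') \<Delta> (pt_ren (ren_up r) w1) C"
    by (rule Case.IH(2), rule *) auto
  moreover have "typed L (B # \<Gamma>') \<Delta> (pt_ren (ren_up r) w2) C"
    by (rule Case.IH(3), rule *) auto
  ultimately show ?case by (auto intro: typed.Case)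
next
  case (TLam \<Gamma> \<Delta> u A)
  have "typed L (map fm_lift \<Gamma>') (map fm_lift \<Delta>) (pt_ren r u) A"
    by (rule TLam.IH) (use TLam.prems in auto)
  then show ?case by (auto intro: typed.TLam)
next
  case (Unpack \<Gamma> \<Delta> u A t C)
  have "typed L \<Gamma>' \<Delta> (pt_ren r u) (Ex A)"
    by (rule Unpack.IH) (use Unpack.prems in auto)
  moreover have "typed L (A # map fm_lift \<Gamma>') (map fm_lift \<Delta>) (pt_ren (ren_up r) t) (fm_lift C)"
  proof (rule Unpack.IH(2))
    fix i assume "i \<in> pt_pv t" "i < length (A # map fm_lift \<Gamma>)"
    then show "ren_up r i < length (A # map fm_lift \<Gamma>') \<and>
        (A # map fm_lift \<Gamma>') ! ren_up r i = (A # map fm_lift \<Gamma>) ! i"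
      using Unpack.prems[of "i - 1"] by (cases i) (auto simp: unbind_def)
  qed
  ultimately show ?case by (auto intro: typed.Unpack)
qed (auto intro: typed.intros)

section \<open>First-order substitution and substitution of proof terms\<close>

lemma typed_fsubst:
  assumes "typed L \<Gamma> \<Delta> t A" and "\<And>n. tm_over L (\<sigma> n)"
  shows "typed L (map (fm_subst \<sigma>) \<Gamma>) (map (fm_subst \<sigma>) \<Delta>) (pt_fsubst \<sigma> t) (fm_subst \<sigma> A)"
  using assms
proof (induction arbitrary: \<sigma> rule: typed.induct)
  case (PVar i \<Gamma> \<Delta>)
  then show ?case using typed.PVar[of i "map (fm_subst \<sigma>) \<Gamma>"] by simp
next
  case (TApp m \<Gamma> \<Delta> u A)
  then show ?case by (auto simp: fm_subst_inst intro!: typed.TApp tm_over_subst)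
next
  case (TLam \<Gamma> \<Delta> u A)
  have "typed L (map (fm_subst (tm_up \<sigma>)) (map fm_lift \<Gamma>)) (map (fm_subst (tm_up \<sigma>)) (map fm_lift \<Delta>))
      (pt_fsubst (tm_up \<sigma>) u) (fm_subst (tm_up \<sigma>) A)"
    by (rule TLam.IH) (use TLam.prems in \<open>auto intro: tm_over_up\<close>)
  then show ?case by (auto simp: comp_def intro: typed.TLam)
next
  case (Wit m \<Gamma> \<Delta> u A)
  then show ?case by (auto simp: fm_subst_inst intro!: typed.Wit tm_over_subst)
next
  case (Unpack \<Gamma> \<Delta> u A t C)
  have "typed L (map (fm_subst (tm_up \<sigma>)) (A # map fm_lift \<Gamma>))
      (map (fm_subst (tm_up \<sigma>)) (map fm_lift \<Delta>))
      (pt_fsubst (tm_up \<sigma>) t) (fm_subst (tm_up \<sigma>) (fm_lift C))"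
    by (rule Unpack.IH) (use Unpack.prems in \<open>auto intro: tm_over_up\<close>)
  moreover have "typed L (map (fm_subst \<sigma>) \<Gamma>) (map (fm_subst \<sigma>) \<Delta>) (pt_fsubst \<sigma> u)
      (Ex (fm_subst (tm_up \<sigma>) A))"
    using Unpack.IH(1)[OF Unpack.prems] by simp
  ultimately show ?case by (auto simp: comp_def intro: typed.Unpack)
next
  case (HypA a \<Delta> A \<Gamma>)
  then show ?case by (auto intro!: typed.HypA simply_universal_subst)
next
  case (HypW a \<Delta> A \<Gamma>)
  then show ?case by (auto intro!: typed.HypW)
next
  case (EM0 P \<Gamma> \<Delta> u C v)
  have "typed L (map (fm_subst \<sigma>) \<Gamma>) (map (fm_subst \<sigma>) \<Delta> @ [Neg (fm_subst \<sigma> P)])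
      (pt_fsubst \<sigma> u) (fm_subst \<sigma> C)"
    "typed L (map (fm_subst \<sigma>) \<Gamma>) (map (fm_subst \<sigma>) \<Delta> @ [fm_subst \<sigma> P])
      (pt_fsubst \<sigma> v) (fm_subst \<sigma> C)"
    using EM0.IH[OF EM0.prems] by simp_all
  with EM0.hyps EM0.prems show ?case
    by (auto intro!: typed.EM0[of L "fm_subst \<sigma> P"] fm_over_subst)
next
  case (EM1 P Q \<Gamma> \<Delta> u v)
  have "typed L (map (fm_subst \<sigma>) \<Gamma>) (All (fm_subst (tm_up \<sigma>) P) # map (fm_subst \<sigma>) \<Delta>)
      (pt_fsubst \<sigma> u) (Ex (fm_subst (tm_up \<sigma>) Q))"
    "typed L (map (fm_subst \<sigma>) \<Gamma>) (Ex (Neg (fm_subst (tm_up \<sigma>) P)) # map (fm_subst \<sigma>) \<Delta>)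
      (pt_fsubst \<sigma> v) (Ex (fm_subst (tm_up \<sigma>) Q))"
    using EM1.IH[OF EM1.prems] by simp_all
  with EM1.hyps EM1.prems show ?case
    by (auto intro!: typed.EM1[of L "fm_subst (tm_up \<sigma>) P"] fm_over_subst tm_over_up)
next
  case (HypZ_Bot P \<Gamma> \<Delta>)
  then show ?case by (auto intro!: typed.HypZ_Bot fm_over_subst)
qed (auto intro: typed.intros fm_over_subst)

lemma typed_flift:
  "typed L \<Gamma> \<Delta> t A \<Longrightarrow> typed L (map fm_lift \<Gamma>) (map fm_lift \<Delta>) (pt_flift t) (fm_lift A)"
  using typed_fsubst[of L \<Gamma> \<Delta> t A "\<lambda>n. Var (Suc n)"] by (simp add: fm_lift_def[abs_def] pt_flift_def)

lemma typed_finst: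
  "typed L \<Gamma> \<Delta> t A \<Longrightarrow> tm_over L m \<Longrightarrow>
    typed L (map (fm_inst m) \<Gamma>) (map (fm_inst m) \<Delta>) (pt_finst m t) (fm_inst m A)"
  using typed_fsubst[of L \<Gamma> \<Delta> t A "case_nat m Var"]
  by (simp add: fm_inst_def[abs_def] pt_finst_def split: nat.split)

lemma typed_pt_up:
  assumes "\<And>i. i < length \<Gamma> \<Longrightarrow> typed L \<Gamma>' \<Delta> (\<sigma> i) (\<Gamma> ! i)" and "i < length (B # \<Gamma>)"
  shows "typed L (B # \<Gamma>') \<Delta> (pt_up \<sigma> i) ((B # \<Gamma>) ! i)"
proof (cases i)
  case 0
  then show ?thesis using typed.PVar[of 0 "B # \<Gamma>'"] by (simp add: pt_up_def)
next
  case (Suc j)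
  have "typed L (B # \<Gamma>') \<Delta> (pt_ren Suc (\<sigma> j)) (\<Gamma> ! j)"
    by (rule typed_ren[OF assms(1)]) (use assms(2) Suc in auto)
  with Suc show ?thesis by (simp add: pt_up_def)
qed

text \<open>Each kind of binder changes the context in which the substituted proofs must be typed:
  proof binders call for \<open>pt_up\<close>, first-order binders for \<open>pt_flift\<close>,
  \<open>EM1\<close> for \<open>pt_hlift\<close>, and \<open>EM0\<close> for weakening at the end of
  \<open>\<Delta>\<close>.\<close>

lemma typed_subst:
  assumes "typed L \<Gamma> \<Delta> t A" and "\<And>i. i < length \<Gamma> \<Longrightarrow> typed L \<Gamma>' \<Delta> (\<sigma> i) (\<Gamma> ! i)"
  shows "typed L \<Gamma>' \<Delta> (pt_subst \<sigma> t) A"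
  using assms
proof (induction arbitrary: \<sigma> \<Gamma>' rule: typed.induct)
  case (App \<Gamma> \<Delta> t A B u)
  have "typed L \<Gamma>' \<Delta> (pt_subst \<sigma> t) (Imp A B)" "typed L \<Gamma>' \<Delta> (pt_subst \<sigma> u) A"
    by (rule App.IH; use App.prems in auto)+
  then show ?case by (auto intro: typed.App)
next
  case (Lam A \<Gamma> \<Delta> u B)
  have "typed L (A # \<Gamma>') \<Delta> (pt_subst (pt_up \<sigma>) u) B"
    by (rule Lam.IH) (use Lam.prems typed_pt_up in blast)
  with Lam.hyps show ?case by (auto intro: typed.Lam)
next
  case (Case \<Gamma> \<Delta> u A B w1 C w2)
  have "typed L \<Gamma>' \<Delta> (pt_subst \<sigma> u) (Or A B)"
    by (rule Case.IH) (use Case.prems in auto)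
  moreover have "typed L (A # \<Gamma>') \<Delta> (pt_subst (pt_up \<sigma>) w1) C"
    "typed L (B # \<Gamma>') \<Delta> (pt_subst (pt_up \<sigma>) w2) C"
    by (rule Case.IH; use Case.prems typed_pt_up in blast)+
  ultimately show ?case by (auto intro: typed.Case)
next
  case (TLam \<Gamma> \<Delta> u A)
  have "typed L (map fm_lift \<Gamma>') (map fm_lift \<Delta>) (pt_subst (\<lambda>n. pt_flift (\<sigma> n)) u) A"
    by (rule TLam.IH) (use TLam.prems in \<open>auto intro: typed_flift\<close>)
  then show ?case by (auto intro: typed.TLam)
next
  case (Unpack \<Gamma> \<Delta> u A t C)
  have "typed L \<Gamma>' \<Delta> (pt_subst \<sigma> u) (Ex A)"
    by (rule Unpack.IH) (use Unpack.prems in auto)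
  moreover have "typed L (A # map fm_lift \<Gamma>') (map fm_lift \<Delta>)
      (pt_subst (pt_up (\<lambda>n. pt_flift (\<sigma> n))) t) (fm_lift C)"
    by (rule Unpack.IH(2), rule typed_pt_up) (use Unpack.prems in \<open>auto intro: typed_flift\<close>)
  ultimately show ?case by (auto intro: typed.Unpack)
next
  case (EM0 P \<Gamma> \<Delta> u C v)
  have "typed L \<Gamma>' (\<Delta> @ [Neg P]) (pt_subst \<sigma> u) C" "typed L \<Gamma>' (\<Delta> @ [P]) (pt_subst \<sigma> v) C"
    by (rule EM0.IH; use EM0.prems typed_weaken_hyps in blast)+
  with EM0.hyps show ?case by (auto intro: typed.EM0)
next
  case (EM1 P Q \<Gamma> \<Delta> u v)
  have "typed L \<Gamma>' (All P # \<Delta>) (pt_subst (\<lambda>n. pt_hlift (\<sigma> n)) u) (Ex Q)"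
    "typed L \<Gamma>' (Ex (Neg P) # \<Delta>) (pt_subst (\<lambda>n. pt_hlift (\<sigma> n)) v) (Ex Q)"
    by (rule EM1.IH; use EM1.prems typed_hlift in blast)+
  with EM1.hyps show ?case by (auto intro: typed.EM1)
qed (auto intro: typed.intros)

lemma typed_inst:
  assumes "typed L (B # \<Gamma>) \<Delta> t A" and "typed L \<Gamma> \<Delta> u B"
  shows "typed L \<Gamma> \<Delta> (pt_inst u t) A"
  unfolding pt_inst_def using assms(1)
proof (rule typed_subst)
  fix i assume "i < length (B # \<Gamma>)"
  then show "typed L \<Gamma> \<Delta> (case i of 0 \<Rightarrow> u | Suc x \<Rightarrow> PVar x) ((B # \<Gamma>) ! i)"
    using assms(2) by (cases i) (auto intro: typed.PVar)
qed


section \<open>Exception substitution\<close>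

inductive_cases typed_appE:
  "typed L \<Gamma> \<Delta> (App t u) C" "typed L \<Gamma> \<Delta> (TApp t m) C" "typed L \<Gamma> \<Delta> (Fst t) C"
  "typed L \<Gamma> \<Delta> (Snd t) C" "typed L \<Gamma> \<Delta> (Case t u v) C" "typed L \<Gamma> \<Delta> (Unpack t u) C"
inductive_cases typed_introE:
  "typed L \<Gamma> \<Delta> (Lam t) C" "typed L \<Gamma> \<Delta> (TLam t) C" "typed L \<Gamma> \<Delta> (Pair t u) C"
  "typed L \<Gamma> \<Delta> (InL t) C" "typed L \<Gamma> \<Delta> (InR t) C" "typed L \<Gamma> \<Delta> (Wit m t) C"
inductive_cases typed_EM_E: "typed L \<Gamma> \<Delta> (EM0 t u) C" "typed L \<Gamma> \<Delta> (EM1 t u) C"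
inductive_cases typed_HypA_E: "typed L \<Gamma> \<Delta> (HypA a A) C"

text \<open>Lifting preserves the outermost quantifier, and the hypotheses of \<open>EM0\<close>,
  being negative propositional, are no candidates. So the formula of a hypothesis decides which kind
  of subterm can refer to it.\<close>

lemma typed_occs:
  assumes "typed L \<Gamma> \<Delta> t C"
  shows "(a, F) \<in> hypA_occs t \<Longrightarrow> a < length \<Delta> \<and> (\<exists>B. \<Delta> ! a = All B)"
    and "(a, F) \<in> hypW_occs t \<Longrightarrow> a < length \<Delta> \<and> (\<exists>B. \<Delta> ! a = Ex B)"
proof -
  from assms have "((a, F) \<in> hypA_occs t \<longrightarrow> a < length \<Delta> \<and> (\<exists>B. \<Delta> ! a = All B)) \<and>
      ((a, F) \<in> hypW_occs t \<longrightarrow> a < length \<Delta> \<and> (\<exists>B. \<Delta> ! a = Ex B))"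
  proof (induction arbitrary: a rule: typed.induct)
    case (TLam \<Gamma> \<Delta> u A)
    show ?case using TLam.IH[of a]
      by (auto cong: conj_cong dest: fm_lift_eq_All fm_lift_eq_Ex)
  next
    case (Unpack \<Gamma> \<Delta> u A t C)
    show ?case using Unpack.IH[of a]
      by (auto cong: conj_cong dest: fm_lift_eq_All fm_lift_eq_Ex)
  next
    case (EM0 P \<Gamma> \<Delta> u C v)
    show ?case using EM0.IH[of a] EM0.hyps(2)
      by (auto simp: nth_append less_Suc_eq split: if_splits)
  next
    case (EM1 P Q \<Gamma> \<Delta> u v)
    show ?case using EM1.IH[of "Suc a"] by (auto simp: unbind_occs_def)
  qed auto
  then show "(a, F) \<in> hypA_occs t \<Longrightarrow> a < length \<Delta> \<and> (\<exists>B. \<Delta> ! a = All B)"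
    and "(a, F) \<in> hypW_occs t \<Longrightarrow> a < length \<Delta> \<and> (\<exists>B. \<Delta> ! a = Ex B)"
    by blast+
qed

text \<open>\<open>hyp_apps\<close> does not relocate annotations out of first-order binders;
  closedness of \<open>All F\<close> makes the annotation agree with the hypothesis in the outer
  context.\<close>

lemma typed_hyp_apps:
  "typed L \<Gamma> \<Delta> t C \<Longrightarrow> (F, m) \<in> hyp_apps a t \<Longrightarrow> fm_fv (All F) = {} \<Longrightarrow>
    a < length \<Delta> \<and> \<Delta> ! a = All F \<and> tm_over L m"
proof (induction arbitrary: a rule: typed.induct)
  case (TApp m' \<Gamma> \<Delta> u A)
  show ?case
  proof (cases "\<exists>b P. u = HypA b P")
    case True
    then show ?thesis using TApp by (auto split: if_splits elim: typed_HypA_E)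
  next
    case False
    then have "(F, m) \<in> hyp_apps a u" using TApp.prems by (cases u) auto
    then show ?thesis using TApp by blast
  qed
next
  case (TLam \<Gamma> \<Delta> u A)
  have *: "a < length (map fm_lift \<Delta>) \<and> map fm_lift \<Delta> ! a = All F \<and> tm_over L m"
    by (rule TLam.IH) (use TLam.prems in simp_all)
  \<comment> \<open>The inner hypothesis is the closed \<open>All F\<close>, so the outer one, of
    which it is the lift, coincides with it.\<close>
  then have "fm_lift (\<Delta> ! a) = \<Delta> ! a"
    using TLam.prems by (intro fm_lift_fv_empty) auto
  with * show ?case by auto
next
  case (Unpack \<Gamma> \<Delta> u A t C)
  then consider "(F, m) \<in> hyp_apps a u" | "(F, m) \<in> hyp_apps a t" by auto
  then show ?case
  proof cases
    case 1
    then show ?thesis using Unpack by blast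
  next
    case 2
    then have *: "a < length (map fm_lift \<Delta>) \<and> map fm_lift \<Delta> ! a = All F \<and> tm_over L m"
      using Unpack by blast
    then have "fm_lift (\<Delta> ! a) = \<Delta> ! a"
      using Unpack.prems by (intro fm_lift_fv_empty) auto
    with * show ?thesis by auto
  qed
next
  case (EM0 P \<Gamma> \<Delta> u C v)
  then consider "(F, m) \<in> hyp_apps a u" | "(F, m) \<in> hyp_apps a v" by auto
  then show ?case
  proof cases
    case 1
    from EM0.IH(1)[OF 1 EM0.prems(2)] show ?thesis
      by (auto simp: nth_append less_Suc_eq split: if_splits)
  next
    case 2
    from EM0.IH(2)[OF 2 EM0.prems(2)] \<open>neg_prop P\<close> show ?thesis
      by (auto simp: nth_append less_Suc_eq split: if_splits)
  qed
next
  case (EM1 P Q \<Gamma> \<Delta> u v)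
  then consider "(F, m) \<in> hyp_apps (Suc a) u" | "(F, m) \<in> hyp_apps (Suc a) v" by auto
  then show ?case using EM1.IH[OF _ EM1.prems(2)] by cases fastforce+
qed auto

lemma mem_map_lift: "P \<in> set \<Delta> \<Longrightarrow> fm_lift P = P \<Longrightarrow> P \<in> fm_lift ` set \<Delta>"
  by force

text \<open>Closedness of \<open>m\<close>, \<open>Ex N\<close> and the instance is expressed as
  invariance under lifting, which passes unchanged under first-order binders together with the
  lifted contexts. Membership of the instance in \<open>\<Delta>\<close> types the
  \<open>HypZ\<close> inserted for \<open>HypW\<close>.\<close>

lemma typed_exc_subst_W:
  assumes "typed L \<Gamma> \<Delta> t C" and "a < length \<Delta>" "\<Delta> ! a = Ex N" "neg_prop N" "tm_over L m"
    and "tm_lift m = m" "fm_lift (Ex N) = Ex N" "fm_lift (fm_inst m N) = fm_inst m N"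
    and "fm_inst m N \<in> set \<Delta>"
  shows "typed L \<Gamma> \<Delta> (exc_subst_W a m t) C"
  using assms
proof (induction arbitrary: a rule: typed.induct)
  case (TLam \<Gamma> \<Delta> u A)
  have "typed L (map fm_lift \<Gamma>) (map fm_lift \<Delta>) (exc_subst_W a m u) A"
    by (rule TLam.IH) (use TLam.prems mem_map_lift in auto)
  with TLam show ?case by (auto intro: typed.TLam)
next
  case (Unpack \<Gamma> \<Delta> u A t C)
  have "typed L (A # map fm_lift \<Gamma>) (map fm_lift \<Delta>) (exc_subst_W a m t) (fm_lift C)"
    by (rule Unpack.IH) (use Unpack.prems mem_map_lift in auto)
  with Unpack show ?case by (auto intro!: typed.Unpack)
next
  case (EM0 P \<Gamma> \<Delta> u C v)
  then show ?case by (auto simp: nth_append intro!: typed.EM0)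
next
  case (EM1 P Q \<Gamma> \<Delta> u v)
  then show ?case by (auto intro!: typed.EM1)
next
  case (HypW b \<Delta> P \<Gamma>)
  then show ?case by (auto intro!: typed.HypW typed.Wit typed.HypZ)
qed (auto intro: typed.intros)

lemma hypW_occs_exc_subst_W: "(a, B) \<notin> hypW_occs (exc_subst_W a m t)"
  by (induction t arbitrary: a m) (auto simp: unbind_occs_def)

text \<open>Only instantiations at \<open>m\<close> are replaced; other uses still refer to
  \<open>a\<close>, so \<open>All P\<close> keeps its place in \<open>\<Delta>\<close>, alongside
  the instance that types the new \<open>HypZ\<close>.\<close>

lemma typed_exc_subst_H:
  assumes "typed L \<Gamma> \<Delta> t C" and "a < length \<Delta>" "\<Delta> ! a = All P" "neg_prop P"
    and "tm_lift m = m" "fm_lift (All P) = All P" "fm_lift (fm_inst m P) = fm_inst m P"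
    and "fm_inst m P \<in> set \<Delta>"
  shows "typed L \<Gamma> \<Delta> (exc_subst_H a m t) C"
  using assms
proof (induction arbitrary: a rule: typed.induct)
  case (TApp l \<Gamma> \<Delta> u A)
  have IH: "typed L \<Gamma> \<Delta> (exc_subst_H a m u) (All A)"
    by (rule TApp.IH) (use TApp.prems in auto)
  show ?case
  proof (cases "\<exists>A. u = HypA a A \<and> l = m")
    case True
    then show ?thesis using TApp by (auto elim!: typed_HypA_E intro!: typed.HypZ)
  next
    case False
    then have "exc_subst_H a m (TApp u l) = TApp (exc_subst_H a m u) l"
      by (auto split: pt.split)
    with IH TApp.hyps show ?thesis by (auto intro: typed.TApp)
  qed
next
  case (TLam \<Gamma> \<Delta> u A)
  have "typed L (map fm_lift \<Gamma>) (map fm_lift \<Delta>) (exc_subst_H a m u) A"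
    by (rule TLam.IH) (use TLam.prems mem_map_lift in auto)
  with TLam show ?case by (auto intro: typed.TLam)
next
  case (Unpack \<Gamma> \<Delta> u A t C)
  have "typed L (A # map fm_lift \<Gamma>) (map fm_lift \<Delta>) (exc_subst_H a m t) (fm_lift C)"
    by (rule Unpack.IH) (use Unpack.prems mem_map_lift in auto)
  with Unpack show ?case by (auto intro!: typed.Unpack)
next
  case (EM0 P \<Gamma> \<Delta> u C v)
  then show ?case by (auto simp: nth_append intro!: typed.EM0)
next
  case (EM1 P Q \<Gamma> \<Delta> u v)
  then show ?case by (auto intro!: typed.EM1)
qed (auto intro: typed.intros)


section \<open>Subject reduction\<close>

lemma tm_fv_subst:
  assumes "tm_fv m \<subseteq> {..<j}" and "\<And>n. n < j \<Longrightarrow> tm_fv (\<sigma> n) \<subseteq> {..<k}"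
  shows "tm_fv (tm_subst \<sigma> m) \<subseteq> {..<k}"
  using assms
proof (induction m)
  case (Fn f ts)
  have "tm_fv (tm_subst \<sigma> m) \<subseteq> {..<k}" if "m \<in> set ts" for m
    by (rule Fn.IH) (use Fn.prems that in auto)
  then show ?case by auto
qed simp

lemma tm_fv_lift: "tm_fv m \<subseteq> {..<k} \<Longrightarrow> tm_fv (tm_lift m) \<subseteq> {..<Suc k}"
  unfolding tm_lift_def by (erule tm_fv_subst) simp

lemma tm_fv_up:
  assumes "\<And>n. n < j \<Longrightarrow> tm_fv (\<sigma> n) \<subseteq> {..<k}" and "n < Suc j"
  shows "tm_fv (tm_up \<sigma> n) \<subseteq> {..<Suc k}"
  using assms by (cases n) (simp_all add: tm_fv_lift)

lemma fm_fv_subst: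
  assumes "fm_fv A \<subseteq> {..<j}" and "\<And>n. n < j \<Longrightarrow> tm_fv (\<sigma> n) \<subseteq> {..<k}"
  shows "fm_fv (fm_subst \<sigma> A) \<subseteq> {..<k}"
  using assms
proof (induction A arbitrary: \<sigma> j k)
  case (Atom p ts)
  have "tm_fv (tm_subst \<sigma> m) \<subseteq> {..<k}" if "m \<in> set ts" for m
    by (rule tm_fv_subst[of _ j]) (use Atom that in auto)
  then show ?case by auto
next
  case (All A)
  have "fm_fv (fm_subst (tm_up \<sigma>) A) \<subseteq> {..<Suc k}"
    by (rule All.IH[of "Suc j"], use All.prems in simp, rule tm_fv_up[OF All.prems(2)])
  then show ?case by simp
next
  case (Ex A)
  have "fm_fv (fm_subst (tm_up \<sigma>) A) \<subseteq> {..<Suc k}"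
    by (rule Ex.IH[of "Suc j"], use Ex.prems in simp, rule tm_fv_up[OF Ex.prems(2)])
  then show ?case by simp
qed (simp_all, metis+)

lemma fm_fv_inst:
  "fm_fv A \<subseteq> {..<Suc k} \<Longrightarrow> tm_fv m \<subseteq> {..<k} \<Longrightarrow> fm_fv (fm_inst m A) \<subseteq> {..<k}"
  unfolding fm_inst_def by (erule fm_fv_subst) (auto split: nat.split)

lemma pt_fv_fsubst:
  assumes "pt_fv t \<subseteq> {..<j}" and "\<And>n. n < j \<Longrightarrow> tm_fv (\<sigma> n) \<subseteq> {..<k}"
  shows "pt_fv (pt_fsubst \<sigma> t) \<subseteq> {..<k}"
  using assms
proof (induction t arbitrary: \<sigma> j k)
  case (TApp t m)
  then show ?case using TApp.IH[of j \<sigma> k] tm_fv_subst[of m j \<sigma> k] by simp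
next
  case (Wit m t)
  then show ?case using Wit.IH[of j \<sigma> k] tm_fv_subst[of m j \<sigma> k] by simp
next
  case (TLam t)
  have "pt_fv (pt_fsubst (tm_up \<sigma>) t) \<subseteq> {..<Suc k}"
    by (rule TLam.IH[of "Suc j"], use TLam.prems in simp, rule tm_fv_up[OF TLam.prems(2)])
  then show ?case by simp
next
  case (Unpack t u)
  have "pt_fv (pt_fsubst (tm_up \<sigma>) u) \<subseteq> {..<Suc k}"
    by (rule Unpack.IH(2)[of "Suc j"], use Unpack.prems in simp, rule tm_fv_up[OF Unpack.prems(2)])
  with Unpack.IH(1)[of j \<sigma> k] Unpack.prems show ?case by simp
next
  case (HypA a A)
  have "fm_fv (fm_subst (tm_up \<sigma>) A) \<subseteq> {..<Suc k}"
    by (rule fm_fv_subst[of _ "Suc j"], use HypA.prems in simp, rule tm_fv_up[OF HypA.prems(2)])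
  then show ?case by simp
next
  case (HypW a A)
  have "fm_fv (fm_subst (tm_up \<sigma>) A) \<subseteq> {..<Suc k}"
    by (rule fm_fv_subst[of _ "Suc j"], use HypW.prems in simp, rule tm_fv_up[OF HypW.prems(2)])
  then show ?case by simp
next
  case (HypZ A)
  then show ?case using fm_fv_subst[of A j \<sigma> k] by simp
qed (simp_all, metis+)

lemma pt_fv_flift: "pt_fv t \<subseteq> {..<k} \<Longrightarrow> pt_fv (pt_flift t) \<subseteq> {..<Suc k}"
  unfolding pt_flift_def by (erule pt_fv_fsubst) simp

lemma pt_fv_finst:
  "pt_fv t \<subseteq> {..<Suc k} \<Longrightarrow> tm_fv m \<subseteq> {..<k} \<Longrightarrow> pt_fv (pt_finst m t) \<subseteq> {..<k}"
  unfolding pt_finst_def by (erule pt_fv_fsubst) (auto split: nat.split)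

lemma pt_fv_hren [simp]: "pt_fv (pt_hren r t) = pt_fv t"
  by (induction t arbitrary: r) auto

lemma pt_fv_ren [simp]: "pt_fv (pt_ren r t) = pt_fv t"
  by (induction t arbitrary: r) auto

lemma pt_fv_up: "(\<And>n. pt_fv (\<sigma> n) \<subseteq> {..<k}) \<Longrightarrow> pt_fv (pt_up \<sigma> n) \<subseteq> {..<k}"
  by (cases n) (auto simp: pt_up_def)

lemma pt_fv_subst:
  assumes "pt_fv t \<subseteq> {..<k}" and "\<And>n. pt_fv (\<sigma> n) \<subseteq> {..<k}"
  shows "pt_fv (pt_subst \<sigma> t) \<subseteq> {..<k}"
  using assms
proof (induction t arbitrary: \<sigma> k)
  case (Unpack t u)
  have "pt_fv (pt_subst (pt_up (\<lambda>n. pt_flift (\<sigma> n))) u) \<subseteq> {..<Suc k}"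
    by (rule Unpack.IH(2), use Unpack.prems in simp, rule pt_fv_up, rule pt_fv_flift,
        rule Unpack.prems)
  with Unpack show ?case by simp
qed (simp_all add: pt_fv_up pt_fv_flift pt_hlift_def)

lemma pt_fv_inst: "pt_fv t \<subseteq> {..<k} \<Longrightarrow> pt_fv u \<subseteq> {..<k} \<Longrightarrow> pt_fv (pt_inst u t) \<subseteq> {..<k}"
  unfolding pt_inst_def by (erule pt_fv_subst) (auto split: nat.split)

lemma pt_fv_exc_subst_W:
  "pt_fv t \<subseteq> {..<k} \<Longrightarrow> tm_fv m \<subseteq> {..<k} \<Longrightarrow> pt_fv (exc_subst_W a m t) \<subseteq> {..<k}"
  by (induction t arbitrary: a m k) (simp_all add: tm_fv_lift fm_fv_inst)

lemma pt_fv_exc_subst_H: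
  "pt_fv t \<subseteq> {..<k} \<Longrightarrow> tm_fv m \<subseteq> {..<k} \<Longrightarrow> pt_fv (exc_subst_H a m t) \<subseteq> {..<k}"
proof (induction t arbitrary: a m k)
  case (TApp t l)
  then have IH: "pt_fv (exc_subst_H a m t) \<subseteq> {..<k}" by simp
  show ?case
  proof (cases "\<exists>A. t = HypA a A \<and> l = m")
    case True
    then obtain A where "t = HypA a A" "l = m" by blast
    then show ?thesis using TApp.prems by (simp add: fm_fv_inst)
  next
    case False
    then have "exc_subst_H a m (TApp t l) = TApp (exc_subst_H a m t) l"
      by (auto split: pt.split)
    with IH TApp.prems show ?thesis by simp
  qed
qed (simp_all add: tm_fv_lift)

text \<open>The term \<open>m\<close> copied by \<open>em1_raise\<close> may come from under
  first-order binders; activity makes it closed, so no variable escapes. With \<open>k = 0\<close>,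
  closed terms stay closed.\<close>

lemma red_fv: "t \<mapsto> t' \<Longrightarrow> pt_fv t \<subseteq> {..<k} \<Longrightarrow> pt_fv t' \<subseteq> {..<k}"
proof (induction arbitrary: k rule: red.induct)
  case (em1_raise P m u v)
  then have "tm_fv m \<subseteq> {..<k}" by (simp add: has_active_def)
  then show ?case
    using em1_raise.prems by (simp add: pt_hdrop_def pt_fv_exc_subst_W pt_fv_exc_subst_H)
qed (simp_all add: pt_fv_inst pt_fv_finst pt_hdrop_def)

text \<open>The new \<open>EM0\<close> decides the instance \<open>fm_inst m F\<close>: its negation
  types the proofs inserted for \<open>HypW\<close> in \<open>v\<close>, and the instance itself
  those replacing the active subterms of \<open>u\<close>.\<close>

lemma subject_reduction_em1_raise:
  assumes act: "has_active 0 F m u" and ty: "typed L \<Gamma> \<Delta> (EM1 u v) C"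
  shows "typed L \<Gamma> \<Delta> (EM0 (pt_hdrop (exc_subst_W 0 m v)) (EM1 (exc_subst_H 0 m u) v)) C"
proof -
  obtain P Q where C: "C = Ex Q" and P: "fm_over L P" "neg_prop P" and Q: "neg_prop Q"
    and u: "typed L \<Gamma> (All P # \<Delta>) u (Ex Q)" and v: "typed L \<Gamma> (Ex (Neg P) # \<Delta>) v (Ex Q)"
    using ty by (elim typed_EM_E) blast
  have cl: "fm_fv (All F) = {}" "tm_fv m = {}" and occ: "(F, m) \<in> hyp_apps 0 u"
    using act by (simp_all add: has_active_def)
  \<comment> \<open>The annotation found in \<open>u\<close>, being closed, is the formula bound by
    \<open>EM1\<close>; typing also puts \<open>m\<close> in the language.\<close>
  have F: "F = P" and m: "tm_over L m"
    using typed_hyp_apps[OF u occ cl(1)] by auto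
  let ?R = "fm_inst m P"
  \<comment> \<open>As \<open>All P\<close> is closed, \<open>P\<close> has at most index 0 free;
    instantiating with the closed \<open>m\<close> leaves nothing free in \<open>?R\<close>.\<close>
  have "fm_fv P \<subseteq> {..<Suc 0}"
    using cl F unbind_subset_iff[of "fm_fv P" 0] by simp
  then have "fm_fv ?R \<subseteq> {..<0}"
    by (rule fm_fv_inst) (simp add: cl)
  then have R: "fm_lift ?R = ?R" by (intro fm_lift_closed) simp
  have lm: "tm_lift m = m" by (rule tm_lift_closed) (rule cl)
  have lP: "fm_lift (All P) = All P" by (rule fm_lift_closed) (use cl F in simp)
  have inst_Neg: "fm_inst m (Neg P) = Neg ?R" by (simp add: fm_inst_def)
  let ?v = "exc_subst_W 0 m v"
  have v': "typed L \<Gamma> (Ex (Neg P) # \<Delta> @ [Neg ?R]) ?v (Ex Q)"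
    using typed_weaken_hyps[OF v, of "[Neg ?R]"] P m lm lP R
    by (intro typed_exc_subst_W[where N = "Neg P"]) (auto simp: inst_Neg fm_lift_def)
  \<comment> \<open>The bound hypothesis is existential, so no \<open>HypA\<close> refers to it, and
    every \<open>HypW\<close> that did has been replaced.\<close>
  have "0 \<notin> pt_hv ?v"
    using typed_occs[OF v', of 0] hypW_occs_exc_subst_W[of 0 _ m v] by (auto simp: pt_hv_def)
  then have left: "typed L \<Gamma> (\<Delta> @ [Neg ?R]) (pt_hdrop ?v) (Ex Q)"
    by (rule typed_hdrop[OF v']) simp
  \<comment> \<open>Other uses of the bound hypothesis may survive in \<open>u\<close>, so this
    branch keeps its \<open>EM1\<close>.\<close>
  have "typed L \<Gamma> (All P # \<Delta> @ [?R]) (exc_subst_H 0 m u) (Ex Q)"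
    using typed_weaken_hyps[OF u, of "[?R]"] P lm lP R
    by (intro typed_exc_subst_H[where P = P]) auto
  moreover have "typed L \<Gamma> (Ex (Neg P) # \<Delta> @ [?R]) v (Ex Q)"
    using typed_weaken_hyps[OF v, of "[?R]"] by simp
  ultimately have "typed L \<Gamma> (\<Delta> @ [?R]) (EM1 (exc_subst_H 0 m u) v) (Ex Q)"
    using P Q by (intro typed.EM1)
  with left show ?thesis
    unfolding C using P m by (intro typed.EM0[of L ?R] fm_over_inst) simp_all
qed

lemma subject_reduction: "t \<mapsto> t' \<Longrightarrow> typed L \<Gamma> \<Delta> t C \<Longrightarrow> typed L \<Gamma> \<Delta> t' C"
proof (induction arbitrary: \<Gamma> \<Delta> C rule: red.induct)
  case (beta u t)
  then show ?case by (blast elim: typed_appE typed_introE intro: typed_inst)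
next
  case (tbeta u m)
  then obtain A where C: "C = fm_inst m A" and m: "tm_over L m"
    and u: "typed L (map fm_lift \<Gamma>) (map fm_lift \<Delta>) u A"
    by (blast elim: typed_appE typed_introE)
  \<comment> \<open>Instantiation cancels the lifting of both contexts.\<close>
  from typed_finst[OF u m] show ?case by (simp add: C comp_def)
next
  case (unpack_wit m u v)
  then obtain A where m: "tm_over L m" and u: "typed L \<Gamma> \<Delta> u (fm_inst m A)"
    and v: "typed L (A # map fm_lift \<Gamma>) (map fm_lift \<Delta>) v (fm_lift C)"
    by (blast elim: typed_appE typed_introE)
  from typed_finst[OF v m] have "typed L (fm_inst m A # \<Gamma>) \<Delta> (pt_finst m v) C"
    by (simp add: comp_def)
  then show ?case using u by (rule typed_inst)
next
  case (case_inl u t0 t1)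
  then show ?case by (blast elim: typed_appE typed_introE intro: typed_inst)
next
  case (case_inr u t0 t1)
  then show ?case by (blast elim: typed_appE typed_introE intro: typed_inst)
next
  case (perm_app u v w)
  then show ?case
    by (blast elim!: typed_appE typed_EM_E intro: typed.EM0 typed.App typed_weaken_hyps)
next
  case (perm_tapp u v m)
  then show ?case
    by (blast elim!: typed_appE typed_EM_E intro: typed.EM0 typed.TApp)
next
  case (perm_case u v w1 w2)
  then show ?case
    by (blast elim!: typed_appE typed_EM_E intro: typed.EM0 typed.Case typed_weaken_hyps)
next
  case (perm_unpack u v w)
  then obtain A P where P: "fm_over L P" "neg_prop P" and u: "typed L \<Gamma> (\<Delta> @ [Neg P]) u (Ex A)"
    and v: "typed L \<Gamma> (\<Delta> @ [P]) v (Ex A)"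
    and w: "typed L (A # map fm_lift \<Gamma>) (map fm_lift \<Delta>) w (fm_lift C)"
    by (blast elim: typed_appE typed_EM_E)
  \<comment> \<open>The permutation copies \<open>w\<close> under both hypotheses of
    \<open>EM0\<close>; lifting commutes with appending, so weakening applies.\<close>
  have w': "typed L (A # map fm_lift \<Gamma>) (map fm_lift (\<Delta> @ [X])) w (fm_lift C)" for X
    using typed_weaken_hyps[OF w] by simp
  show ?case
    by (rule typed.EM0[OF P]; rule typed.Unpack) (rule u v w')+
next
  case (em1_drop u v)
  then obtain P where "typed L \<Gamma> (All P # \<Delta>) u C" by (blast elim: typed_EM_E)
  then show ?case by (rule typed_hdrop) (use em1_drop in simp_all)
next
  case (em1_raise P m u v)
  then show ?case by (rule subject_reduction_em1_raise)
qed (blast elim!: typed_appE typed_introE typed_EM_E intro: typed.intros)+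

lemma subject_reduction_star: "t \<mapsto>\<^sup>* t' \<Longrightarrow> typed L \<Gamma> \<Delta> t C \<Longrightarrow> typed L \<Gamma> \<Delta> t' C"
  by (induction rule: rtranclp_induct) (auto intro: subject_reduction)

lemma reds_fv: "t \<mapsto>\<^sup>* t' \<Longrightarrow> pt_fv t = {} \<Longrightarrow> pt_fv t' = {}"
proof (induction rule: rtranclp_induct)
  case (step t' t'')
  then show ?case using red_fv[of t' t'' 0] by simp
qed simp


section \<open>Normal forms\<close>

text \<open>One active instance is asked for each hypothesis and annotation, not for each
  occurrence; at the bound index this is the premise of \<open>em1_raise\<close>.\<close>

definition hyps_active :: "('f, 'p) pt \<Rightarrow> bool" where
  "hyps_active t \<longleftrightarrow> (\<forall>(a, A) \<in> hypA_occs t. \<exists>m. has_active a A m t)"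

lemma hyps_active_intros:
  "hyps_active (PVar i)" "hyps_active (HypZ A)"
  "hyps_active t \<Longrightarrow> hyps_active u \<Longrightarrow> hyps_active (App t u)"
  "hyps_active t \<Longrightarrow> hyps_active u \<Longrightarrow> hyps_active (Pair t u)"
  "hyps_active t \<Longrightarrow> hyps_active u \<Longrightarrow> hyps_active (EM0 t u)"
  "hyps_active t \<Longrightarrow> hyps_active (Lam t)" "hyps_active t \<Longrightarrow> hyps_active (Fst t)"
  "hyps_active t \<Longrightarrow> hyps_active (Snd t)" "hyps_active t \<Longrightarrow> hyps_active (Wit m t)"
  unfolding hyps_active_def has_active_def by fastforce+

text \<open>A bare hypothesis becomes active through the closed application itself; any other head
  keeps the active instances it already had.\<close>

lemma hyps_active_TApp:
  assumes "pt_fv (TApp t m) = {}" and "(\<forall>a A. t \<noteq> HypA a A) \<longrightarrow> hyps_active t"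
  shows "hyps_active (TApp t m)"
proof (cases "\<exists>a A. t = HypA a A")
  case True
  then show ?thesis using assms(1) by (auto simp: hyps_active_def has_active_def)
next
  case False
  then have "hyp_apps a (TApp t m) = hyp_apps a t" for a by (cases t) auto
  then show ?thesis using assms(2) False by (auto simp: hyps_active_def has_active_def)
qed

section \<open>Heads of normal terms\<close>

fun elim_form :: "('f, 'p) pt \<Rightarrow> bool" where
  "elim_form (PVar _) = True"
| "elim_form (App _ _) = True"
| "elim_form (TApp _ _) = True"
| "elim_form (Fst _) = True"
| "elim_form (Snd _) = True"
| "elim_form (HypA _ _) = True"
| "elim_form (HypZ _) = True"
| "elim_form _ = False"

text \<open>\<open>EM0\<close> counts as an introduction because every elimination applied to it is
  a redex, by a permutation. \<open>Case\<close>, \<open>Unpack\<close>, \<open>EM1\<close> and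
  \<open>HypW\<close> belong to neither class.\<close>

fun intro_form :: "('f, 'p) pt \<Rightarrow> bool" where
  "intro_form (Lam _) = True"
| "intro_form (TLam _) = True"
| "intro_form (Pair _ _) = True"
| "intro_form (InL _) = True"
| "intro_form (InR _) = True"
| "intro_form (Wit _ _) = True"
| "intro_form (EM0 _ _) = True"
| "intro_form _ = False"

lemma normal_subterms:
  "normal (App t u) \<Longrightarrow> normal t \<and> normal u" "normal (TApp t m) \<Longrightarrow> normal t"
  "normal (Fst t) \<Longrightarrow> normal t" "normal (Snd t) \<Longrightarrow> normal t"
  "normal (Case t u v) \<Longrightarrow> normal t" "normal (Unpack t u) \<Longrightarrow> normal t"
  "normal (Lam t) \<Longrightarrow> normal t" "normal (Pair t u) \<Longrightarrow> normal t \<and> normal u"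
  "normal (Wit m t) \<Longrightarrow> normal t" "normal (EM0 t u) \<Longrightarrow> normal t \<and> normal u"
  "normal (EM1 t u) \<Longrightarrow> normal t"
  unfolding normal_def by (blast intro: red.intros)+

text \<open>With the given outermost connective, typing leaves only the matching introduction or
  \<open>EM0\<close>; eliminating the former contracts and eliminating the latter permutes, against
  normality.\<close>

lemma normal_elim_head:
  assumes "typed L \<Gamma> \<Delta> t C" and "intro_form t"
  shows "normal (App t u) \<Longrightarrow> C \<noteq> Imp A B" "normal (TApp t m) \<Longrightarrow> C \<noteq> All A"
    "normal (Fst t) \<Longrightarrow> C \<noteq> And A B" "normal (Snd t) \<Longrightarrow> C \<noteq> And A B"
    "normal (Case t w1 w2) \<Longrightarrow> C \<noteq> Or A B" "normal (Unpack t u) \<Longrightarrow> C \<noteq> Ex A"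
  using assms unfolding normal_def
  by (cases t; auto elim: typed_introE intro: red.intros)+

text \<open>A hypothesis of a simply universal type can only be eliminated by instantiation, and in a
  closed term whose type contains no quantifier nothing binds a first-order variable, so the
  instance is closed, that is, active.\<close>

lemma normal_form:
  assumes "typed L \<Gamma> \<Delta> t C" and "normal t" and "pt_fv t = {}"
    and "\<And>B. B \<in> set \<Gamma> \<Longrightarrow> neg_prop B" and "\<And>B. Ex B \<notin> set \<Delta>"
  shows "(intro_form t \<or>
      elim_form t \<and> simply_universal C \<and> ((\<forall>a A. t \<noteq> HypA a A) \<longrightarrow> hyps_active t)) \<and>
    (neg_prop C \<or> (\<exists>Q. C = Ex Q \<and> neg_prop Q) \<longrightarrow> hyps_active t) \<and>
    (\<forall>A. C = Ex A \<longrightarrow> herbrand_nf t)"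
  using assms
\<comment> \<open>The first conjunct excludes blocked eliminations, the second makes
  \<open>em1_raise\<close> fire at \<open>EM1\<close>, the third is the goal. A bare
  \<open>HypA\<close> is exempt from activity in the first, since it becomes active only when
  instantiated.\<close>
proof (induction rule: typed.induct)
  case (PVar i \<Gamma> \<Delta>)
  then have "neg_prop (\<Gamma> ! i)" by simp
  then show ?case
    using neg_prop_simply_universal by (auto intro: hyps_active_intros)
next
  case (Pair \<Gamma> \<Delta> u A t B)
  then show ?case using normal_subterms(8)[of u t] by (auto intro: hyps_active_intros)
next
  case (Fst \<Gamma> \<Delta> u A B)
  then have n: "normal u" by (blast dest: normal_subterms)
  have "\<not> intro_form u" using normal_elim_head(3)[OF Fst.hyps] Fst.prems by blast
  \<comment> \<open>A \<open>HypA\<close> has a universal type, so \<open>u\<close> is not one and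
    its activity is available.\<close>
  then have "simply_universal (And A B)" "hyps_active u"
    using Fst.IH[OF n] Fst.prems Fst.hyps by (auto elim: typed_HypA_E)
  then show ?case
    using simply_universal_cases neg_prop_simply_universal by (fastforce intro: hyps_active_intros)
next
  case (Snd \<Gamma> \<Delta> u A B)
  then have n: "normal u" by (blast dest: normal_subterms)
  have "\<not> intro_form u" using normal_elim_head(4)[OF Snd.hyps] Snd.prems by blast
  then have "simply_universal (And A B)" "hyps_active u"
    using Snd.IH[OF n] Snd.prems Snd.hyps by (auto elim: typed_HypA_E)
  then show ?case
    using simply_universal_cases neg_prop_simply_universal by (fastforce intro: hyps_active_intros)
next
  case (App \<Gamma> \<Delta> t A B u)
  then have n: "normal t" "normal u" by (blast dest: normal_subterms)+
  have "\<not> intro_form t" using normal_elim_head(1)[OF App.hyps(1)] App.prems by blast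
  then have su: "simply_universal (Imp A B)" and t: "hyps_active t"
    using App.IH(1)[OF n(1)] App.prems App.hyps by (auto elim: typed_HypA_E)
  then have np: "neg_prop A" "neg_prop B"
    using simply_universal_cases[OF su] by auto
  \<comment> \<open>The argument has a negative propositional type, so the second conjunct covers
    it.\<close>
  then have "hyps_active u" using App.IH(2)[OF n(2)] App.prems by auto
  with t have "hyps_active (App t u)" by (rule hyps_active_intros)
  then show ?case using np neg_prop_simply_universal by auto
next
  case (Lam A \<Gamma> \<Delta> u B)
  \<comment> \<open>Activity is demanded only if \<open>Imp A B\<close> is negative propositional;
    then so is \<open>A\<close>, and it may join the context.\<close>
  then show ?case using normal_subterms(7)[of u] by (auto intro: hyps_active_intros)
next
  case (Case \<Gamma> \<Delta> u A B w1 C w2)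
  then have n: "normal u" by (blast dest: normal_subterms)
  have "\<not> intro_form u" using normal_elim_head(5)[OF Case.hyps(1)] Case.prems by blast
  then have "simply_universal (Or A B)"
    using Case.IH(1)[OF n] Case.prems by auto
  then show ?case using simply_universal_cases by fastforce
next
  case (TApp m \<Gamma> \<Delta> u A)
  then have n: "normal u" by (blast dest: normal_subterms)
  have "\<not> intro_form u" using normal_elim_head(2)[OF TApp.hyps(2)] TApp.prems by blast
  then have su: "simply_universal (All A)" and u: "(\<forall>a A. u \<noteq> HypA a A) \<longrightarrow> hyps_active u"
    using TApp.IH[OF n] TApp.prems by auto
  have "hyps_active (TApp u m)"
    by (rule hyps_active_TApp) (use TApp.prems u in auto)
  moreover have su': "simply_universal (fm_inst m A)"
    using su by (simp add: simply_universal_inst)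
  \<comment> \<open>This makes the third conjunct vacuous.\<close>
  moreover have "fm_inst m A \<noteq> Ex B" for B
    using su' simply_universal_cases[of "Ex B"] by auto
  ultimately show ?case by auto
next
  case (Wit m \<Gamma> \<Delta> u A)
  then show ?case
    using normal_subterms(9)[of m u] by (auto intro: hyps_active_intros herbrand_nf.intros)
next
  case (Unpack \<Gamma> \<Delta> u A t C)
  then have n: "normal u" by (blast dest: normal_subterms)
  have "\<not> intro_form u" using normal_elim_head(6)[OF Unpack.hyps(1)] Unpack.prems by blast
  then have "simply_universal (Ex A)"
    using Unpack.IH(1)[OF n] Unpack.prems by auto
  then show ?case using simply_universal_cases by fastforce
next
  case (HypZ P \<Delta> \<Gamma>)
  then show ?case by (auto intro: hyps_active_intros neg_prop_simply_universal)
next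
  case (HypZ_Bot P \<Gamma> \<Delta>)
  then show ?case by (auto intro: hyps_active_intros neg_prop_simply_universal)
next
  case (HypW a \<Delta> P \<Gamma>)
  then show ?case by (metis nth_mem)
next
  case (EM0 P \<Gamma> \<Delta> u C v)
  have n: "normal u" "normal v" using EM0.prems(1) by (blast dest: normal_subterms)+
  have "Ex B \<notin> set (\<Delta> @ [Neg P])" "Ex B \<notin> set (\<Delta> @ [P])" for B
    using EM0.prems EM0.hyps(2) by auto
  then show ?case
    using EM0.IH(1)[OF n(1)] EM0.IH(2)[OF n(2)] EM0.prems
    by (auto intro: hyps_active_intros herbrand_nf.intros)
next
  case (EM1 P Q \<Gamma> \<Delta> u v)
  have n: "normal u" using EM1.prems(1) by (blast dest: normal_subterms)
  \<comment> \<open>The hypothesis added for \<open>u\<close> is universal, so the context condition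
    survives and the induction hypothesis applies; since \<open>Q\<close> is negative propositional,
    it yields activity.\<close>
  have Ex: "Ex B \<notin> set (All P # \<Delta>)" for B using EM1.prems by auto
  have u: "hyps_active u" using EM1.IH(1)[OF n _ _ Ex] EM1.prems EM1.hyps by auto
  have "0 \<in> pt_hv u"
    using EM1.prems(1) unfolding normal_def by (blast intro: red.em1_drop)
  \<comment> \<open>Index 0 has type \<open>All P\<close>, so it can occur only in a
    \<open>HypA\<close>.\<close>
  then obtain A where "(0, A) \<in> hypA_occs u"
    using typed_occs[OF EM1.hyps(4), of 0] by (fastforce simp: pt_hv_def)
  with u obtain m where "has_active 0 A m u" by (auto simp: hyps_active_def)
  then have False
    using EM1.prems(1) unfolding normal_def by (blast intro: red.em1_raise)
  then show ?case ..
qed (auto intro: neg_prop_simply_universal)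


section \<open>Herbrand disjunctions\<close>

lemma big_or_snoc: "As \<noteq> [] \<Longrightarrow> big_or (As @ [A]) = Or (big_or As) A"
  by (simp add: big_or_def)

lemma fm_over_big_or: "As \<noteq> [] \<Longrightarrow> \<forall>A \<in> set As. fm_over L A \<Longrightarrow> fm_over L (big_or As)"
proof (induction As rule: rev_induct)
  case (snoc A As)
  then show ?case by (cases "As = []") (auto simp: big_or_snoc, simp add: big_or_def)
qed simp

text \<open>\<open>big_or\<close> nests to the left, so the list is taken apart at its end: the last
  entry is injected by \<open>InR\<close>, an earlier one by recursion and
  \<open>InL\<close>.\<close>

lemma typed_big_or:
  assumes "typed L \<Gamma> \<Delta> u A" and "A \<in> set As" and "\<forall>A \<in> set As. fm_over L A"
  shows "\<exists>s. typed L \<Gamma> \<Delta> s (big_or As)"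
  using assms(2,3)
proof (induction As rule: rev_induct)
  case (snoc B Bs)
  show ?case
  proof (cases "Bs = []")
    case True
    then show ?thesis using snoc.prems assms(1) by (auto simp: big_or_def)
  next
    case False
    show ?thesis
    proof (cases "A \<in> set Bs")
      case True
      then obtain s where "typed L \<Gamma> \<Delta> s (big_or Bs)" using snoc by auto
      then show ?thesis
        using False snoc.prems by (auto simp: big_or_snoc intro: typed.InL)
    next
      case notin: False
      then have "A = B" using snoc.prems by simp
      then show ?thesis
        using False snoc.prems assms(1) fm_over_big_or[of Bs L]
        by (auto simp: big_or_snoc intro: typed.InR)
    qed
  qed
qed simp

lemma components_over:
  "herbrand_nf t \<Longrightarrow> typed L \<Gamma> \<Delta> t (Ex A) \<Longrightarrow> (m, u) \<in> set (components t) \<Longrightarrow> tm_over L m"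
proof (induction arbitrary: \<Delta> rule: herbrand_nf.induct)
  case (1 m' u')
  then show ?case by (auto elim: typed_introE)
next
  case (2 u v)
  then show ?case by (auto elim!: typed_EM_E)
qed

text \<open>\<open>As\<close> is a fixed list covering all instances, so that both branches of every
  \<open>EM0\<close> prove the same disjunction while the hypotheses vary.\<close>

lemma typed_herbrand_disjunction:
  "herbrand_nf t \<Longrightarrow> typed L \<Gamma> \<Delta> t (Ex A) \<Longrightarrow>
    (\<lambda>(m, u). fm_inst m A) ` set (components t) \<subseteq> set As \<Longrightarrow> \<forall>A \<in> set As. fm_over L A \<Longrightarrow>
    \<exists>s. typed L \<Gamma> \<Delta> s (big_or As)"
proof (induction arbitrary: \<Delta> rule: herbrand_nf.induct)
  case (1 m u)
  then have "typed L \<Gamma> \<Delta> u (fm_inst m A)" by (auto elim: typed_introE)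
  then show ?case by (rule typed_big_or) (use 1 in auto)
next
  case (2 u v)
  from \<open>typed L \<Gamma> \<Delta> (EM0 u v) (Ex A)\<close> obtain P where P: "fm_over L P" "neg_prop P"
    and "typed L \<Gamma> (\<Delta> @ [Neg P]) u (Ex A)" "typed L \<Gamma> (\<Delta> @ [P]) v (Ex A)"
    by (blast elim: typed_EM_E)
  with 2 obtain s s' where "typed L \<Gamma> (\<Delta> @ [Neg P]) s (big_or As)" "typed L \<Gamma> (\<Delta> @ [P]) s' (big_or As)"
    by (metis (no_types, lifting) components.simps(2) image_Un le_sup_iff set_append)
  with P show ?case by (blast intro: typed.EM0)
qed

theorem theorem3p11:
  fixes L :: "('f, 'p) lang" and A :: "('f, 'p) fm" and \<Gamma> \<Delta> :: "('f, 'p) fm list"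
    and t t' :: "('f, 'p) pt"
  assumes "\<forall>B \<in> set \<Gamma> \<union> set \<Delta>. fm_over L B"
    and "fm_over L (Ex A)" and "fm_fv (Ex A) = {}"
    and "typed L \<Gamma> \<Delta> t (Ex A)" and "quasi_closed t"
    and "t \<mapsto>\<^sup>* t'" and "normal t'"
  shows "typed L \<Gamma> \<Delta> t' (Ex A) \<and> herbrand_nf t' \<and>
    (\<exists>s. typed L \<Gamma> \<Delta> s (big_or (map (\<lambda>(m, u). fm_inst m A) (components t'))))"
proof -
  \<comment> \<open>Existential hypotheses become \<open>Bot\<close>, which keeps all positions and
    meets the context condition of \<open>normal_form\<close>.\<close>
  let ?\<Delta> = "map (\<lambda>B. if \<exists>F. B = Ex F then Bot else B) \<Delta>"
  have qc: "pt_pv t = {}" "pt_fv t = {}" "hypW_occs t = {}"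
    using assms(5) by (simp_all add: quasi_closed_def)
  have t': "typed L \<Gamma> \<Delta> t' (Ex A)"
    using assms(6,4) by (rule subject_reduction_star)
  \<comment> \<open>Identity renamings leave \<open>t\<close> unchanged and only exchange the
    context; here \<open>\<Gamma>\<close> is emptied, since no proof variable is free.\<close>
  have "typed L [] \<Delta> (pt_ren (\<lambda>n. n) t) (Ex A)"
    using assms(4) by (rule typed_ren) (simp add: qc)
  then have t_ren: "typed L [] \<Delta> t (Ex A)" by simp
  have "typed L [] ?\<Delta> (pt_hren (\<lambda>n. n) t) (Ex A)"
    using t_ren
  proof (rule typed_hren)
    fix a assume "a \<in> pt_hv t" "a < length \<Delta>"
    \<comment> \<open>Without free \<open>HypW\<close>, an index in use occurs in a
      \<open>HypA\<close>, so its hypothesis is universal and was not replaced.\<close>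
    then show "a < length ?\<Delta> \<and> ?\<Delta> ! a = \<Delta> ! a"
      using typed_occs(1)[OF t_ren, of a] qc(3) by (auto simp: pt_hv_def)
  next
    fix P assume "P \<in> set \<Delta>" "neg_prop P"
    then show "P \<in> set ?\<Delta>" by (auto simp: image_iff intro!: bexI[of _ P])
  qed
  \<comment> \<open>Reducing in the trimmed context determines the shape of \<open>t'\<close>; the
    typing in the original context serves for the disjunction.\<close>
  then have "typed L [] ?\<Delta> t' (Ex A)"
    using subject_reduction_star[OF assms(6)] by simp
  then have hnf: "herbrand_nf t'"
    using normal_form[of L "[]" ?\<Delta> t' "Ex A"] assms(7) reds_fv[OF assms(6) qc(2)] by auto
  have "fm_over L (fm_inst m A)" if "(m, u) \<in> set (components t')" for m u
    using components_over[OF hnf t' that] assms(2) by (simp add: fm_over_inst)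
  then have "\<exists>s. typed L \<Gamma> \<Delta> s (big_or (map (\<lambda>(m, u). fm_inst m A) (components t')))"
    by (intro typed_herbrand_disjunction[OF hnf t']) auto
  with t' hnf show ?thesis by blast
qed

end
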